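(* Let $(\theta_\xi,\theta_x)^T\in[0,2\pi]^2$. Then the far-field pattern satisfies $$A^\infty_B((\theta_\xi,\theta_x)^T;\sigma,\mu,\omega)=\sum_{m,n\in\mathbb{Z}}e^{im(\frac\pi2-\theta_\xi)}\,e^{in(\theta_x-\frac\pi2)}\,W_{n,m}[B,\sigma,\mu,\omega].$$
   Context: $\omega>0$ is a fixed frequency; $(|x|,\theta_x)$ are polar coordinates of $x\in\mathbb{R}^2$. $\sigma,\mu$ are positive functions on $\mathbb{R}^2$ such that $\frac1\sigma$ and $\mu$ are bounded and measurable, $0<\lambda_1\le\frac1\sigma\le\lambda_2$ and $0<\lambda_3\le\mu\le\lambda_4$ for constants $\lambda_j$, and $\frac1\sigma-1$, $\mu-1$ are compactly supported. $B\subset\mathbb{R}^2$ is a bounded domain with Lipschitz boundary, containing the origin, with $\operatorname{supp}(\frac1\sigma-1)\subset B$ and $\operatorname{supp}(\mu-1)\subset B$; $\nu$ is the outward unit normal on $\partial B$. Standing assumptions: $\omega^2$ is not a Neumann eigenvalue of $-\frac1\mu\nabla\cdot\frac1\sigma\nabla$ on $B$ and not a Dirichlet eigenvalue of $-\Delta$ on $B$. $\Gamma_\omega(x)=-\frac i4H_0^{(1)}(\omega|x|)$; $S^\omega_B[\phi](x)=\int_{\partial B}\Gamma_\omega(x-y)\phi(y)\,dS_y$; $(K^\omega_B)^*[\phi](x)=\int_{\partial B}\frac{\partial\Gamma_\omega}{\partial\nu_x}(x-y)\phi(y)\,dS_y$ for $x\in\partial B$ (principal value). $\Lambda_{\sigma,\mu}[g]=w|_{\partial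 B}$, where $w$ solves $\nabla\cdot\frac1\sigma\nabla w+\omega^2\mu w=0$ in $B$, $\frac1\sigma\frac{\partial w}{\partial\nu}=g$ on $\partial B$. The operator $$\mathcal{A}=\begin{bmatrix}-S^\omega_B & \Lambda_{\sigma,\mu}\\ -\left(\frac12I+(K^\omega_B)^*\right) & I\end{bmatrix}:L^2(\partial B)\times L^2(\partial B)\to H^1(\partial B)\times L^2(\partial B)$$ is invertible. With the cylindrical waves $\mathcal{C}_m(x)=J_m(\omega|x|)e^{im\theta_x}$ ($J_m$ Bessel functions), let $(\phi_m,\psi_m)$ be the solution of $\mathcal{A}(\phi_m,\psi_m)^T=(\mathcal{C}_m,\frac{\partial\mathcal{C}_m}{\partial\nu})^T$ on $\partial B$. The scattering coefficients are $W_{n,m}[B,\sigma,\mu,\omega]=\int_{\partial B}\overline{\mathcal{C}_n(y)}\,\phi_m(y)\,dS_y$, $n,m\in\mathbb{Z}$. The far-field pattern (scattering amplitude) for the incident plane wave $U(x)=e^{i\omega\xi\cdot x}$, $|\xi|=1$, where $\theta_\xi$ is the polar angle of $\xi$, is the $2\pi$-periodic function (in both variables) $$A^\infty_B((\theta_\xi,\theta_x)^T;\sigma,\mu,\omega)=\sum_{m\in\mathbb{Z}}e^{im(\frac\pi2-\theta_\xi)}\int_{\partial B}e^{-i\omega|y|\cos(\theta_x-\theta_y)}\,\phi_m(y)\,dS_y .$$ *)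

theory Defs
  imports "HOL-Analysis.Analysis"
begin

text \<open>
  The plane is the type \<^typ>\<open>complex\<close>, with its structure as a two-dimensional Euclidean space:
  \<^term>\<open>norm x\<close> and \<^term>\<open>Arg x\<close> are the polar coordinates of \<^term>\<open>x\<close>, the inner product
  is that of the plane, and \<^term>\<open>Basis :: complex set\<close> consists of the two unit coordinate vectors.
  A function on a subset of the plane is a total function whose values elsewhere are irrelevant.
\<close>

subsection \<open>Special functions\<close>

text \<open>
  \<open>rGamma\<close> is the reciprocal Gamma function, which vanishes at the nonpositive integers; hence the
  series is also correct for negative \<open>m\<close>, where it gives \<open>(-1) ^ m\<close> times the function of order \<open>-m\<close>.
\<close>
definition Bessel_J :: "int \<Rightarrow> real \<Rightarrow> real" where
  "Bessel_J m x =
     (\<Sum>k. (-1) ^ k * rGamma (of_int m + of_nat k + 1) / fact k * (x / 2) powi (2 * int k + m))"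

definition Bessel_Y0 :: "real \<Rightarrow> real" where
  "Bessel_Y0 x = 2 / pi * (ln (x / 2) + euler_mascheroni) * Bessel_J 0 x
     - 2 / pi * (\<Sum>k. (-1) ^ k * harm k * (x\<^sup>2 / 4) ^ k / (fact k)\<^sup>2)"

definition Hankel1_0 :: "real \<Rightarrow> complex" where
  "Hankel1_0 x = Complex (Bessel_J 0 x) (Bessel_Y0 x)"

definition cyl_wave :: "real \<Rightarrow> int \<Rightarrow> complex \<Rightarrow> complex" where
  "cyl_wave \<omega> m x = of_real (Bessel_J m (\<omega> * norm x)) * cis (of_int m * Arg x)"

definition fund_sol :: "real \<Rightarrow> complex \<Rightarrow> complex" where
  "fund_sol \<omega> x = - (\<i> / 4) * Hankel1_0 (\<omega> * norm x)"

subsection \<open>Lipschitz domains, arclength and the outward normal\<close>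

text \<open>
  Near each boundary point the domain is, in the orthonormal coordinates
  \<open>Re ((x - p) * cnj u)\<close>, \<open>Im ((x - p) * cnj u)\<close>, the set above the graph of a Lipschitz function.
\<close>
definition lipschitz_domain :: "complex set \<Rightarrow> bool" where
  "lipschitz_domain B \<longleftrightarrow> open B \<and> connected B \<and> B \<noteq> {} \<and>
     (\<forall>p\<in>frontier B. \<exists>u r L. \<exists>\<gamma> :: real \<Rightarrow> real.
        norm u = 1 \<and> 0 < r \<and> lipschitz_on L UNIV \<gamma> \<and>
        B \<inter> ball p r = {x \<in> ball p r. \<gamma> (Re ((x - p) * cnj u)) < Im ((x - p) * cnj u)})"

text \<open>One-dimensional Hausdorff outer measure, normalised so that it is arclength on curves.\<close>
definition hausdorff1 :: "complex set \<Rightarrow> ennreal" where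
  "hausdorff1 A =
     (SUP \<delta>\<in>{0<..}. INF E\<in>{E :: nat \<Rightarrow> complex set.
          A \<subseteq> (\<Union>i. E i) \<and> (\<forall>i. bounded (E i) \<and> diameter (E i) \<le> \<delta>)}.
        (\<Sum>i. ennreal (diameter (E i))))"

text \<open>
  \<open>hausdorff1\<close> is a metric outer measure, hence countably additive on the Borel sets
  (so that \<open>measure_of\<close> does not fall back to the null measure). As for \<open>lebesgue\<close>,
  the measure is completed.
\<close>
definition bdry :: "complex set \<Rightarrow> complex measure" where
  "bdry B = restrict_space (completion (measure_of UNIV (sets borel) hausdorff1)) (frontier B)"

text \<open>
  The domain stays on the inner side, and its complement on the outer side, of the tangent line
  up to arbitrarily thin cones. There is at most one such vector, and on a Lipschitz boundary
  there is one almost everywhere.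
\<close>
definition is_outward_normal :: "complex set \<Rightarrow> complex \<Rightarrow> complex \<Rightarrow> bool" where
  "is_outward_normal B x n \<longleftrightarrow> norm n = 1 \<and>
     (\<forall>\<epsilon>>0. \<forall>\<^sub>F h in nhds 0.
        (\<epsilon> * norm h < h \<bullet> n \<longrightarrow> x + h \<notin> B) \<and> (h \<bullet> n < - \<epsilon> * norm h \<longrightarrow> x + h \<in> closure B))"

definition outward_normal :: "complex set \<Rightarrow> complex \<Rightarrow> complex" where
  "outward_normal B x =
     (if \<exists>n. is_outward_normal B x n then THE n. is_outward_normal B x n else 0)"

definition normal_deriv :: "complex set \<Rightarrow> (complex \<Rightarrow> complex) \<Rightarrow> complex \<Rightarrow> complex" where
  "normal_deriv B F x = frechet_derivative F (at x) (outward_normal B x)"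

text \<open>The unit tangent is the outward normal rotated by a right angle.\<close>
definition tangential_deriv :: "complex set \<Rightarrow> (complex \<Rightarrow> complex) \<Rightarrow> complex \<Rightarrow> complex" where
  "tangential_deriv B F x = frechet_derivative F (at x) (\<i> * outward_normal B x)"

subsection \<open>Function spaces\<close>

definition L2 :: "complex measure \<Rightarrow> (complex \<Rightarrow> complex) set" where
  "L2 M = {f \<in> borel_measurable M. integrable M (\<lambda>x. (norm (f x))\<^sup>2)}"

definition L2_norm :: "complex measure \<Rightarrow> (complex \<Rightarrow> complex) \<Rightarrow> real" where
  "L2_norm M f = sqrt (\<integral>x. (norm (f x))\<^sup>2 \<partial>M)"

definition L2_conv ::
    "complex measure \<Rightarrow> (nat \<Rightarrow> complex \<Rightarrow> complex) \<Rightarrow> (complex \<Rightarrow> complex) \<Rightarrow> bool" where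
  "L2_conv M F f \<longleftrightarrow> (\<lambda>k. \<integral>\<^sup>+x. ennreal ((norm (F k x - f x))\<^sup>2) \<partial>M) \<longlonglongrightarrow> 0"

definition C1 :: "(complex \<Rightarrow> complex) \<Rightarrow> bool" where
  "C1 F \<longleftrightarrow> (\<forall>x. F differentiable (at x)) \<and>
     (\<forall>e. continuous_on UNIV (\<lambda>x. frechet_derivative F (at x) e))"

definition C1_compact_support :: "complex set \<Rightarrow> (complex \<Rightarrow> complex) \<Rightarrow> bool" where
  "C1_compact_support B F \<longleftrightarrow> C1 F \<and>
     compact (closure (support_on UNIV F)) \<and> closure (support_on UNIV F) \<subseteq> B"

text \<open>
  Weak gradients are indexed by the coordinate direction \<open>e\<close>:
  \<open>sobolev_H1 B u G\<close> says that \<open>u\<close> is in the Sobolev space of order one on \<open>B\<close>, with weak partial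
  derivatives \<open>G e\<close>.
\<close>
definition sobolev_H1 ::
    "complex set \<Rightarrow> (complex \<Rightarrow> complex) \<Rightarrow> (complex \<Rightarrow> complex \<Rightarrow> complex) \<Rightarrow> bool" where
  "sobolev_H1 B u G \<longleftrightarrow> u \<in> L2 (lebesgue_on B) \<and>
     (\<forall>e\<in>Basis. G e \<in> L2 (lebesgue_on B) \<and>
        (\<forall>\<phi>. C1_compact_support B \<phi> \<longrightarrow>
           (\<integral>x. u x * frechet_derivative \<phi> (at x) e \<partial>lebesgue_on B)
             = - (\<integral>x. G e x * \<phi> x \<partial>lebesgue_on B)))"

definition H1_conv ::
    "complex set \<Rightarrow> (nat \<Rightarrow> complex \<Rightarrow> complex) \<Rightarrow> (complex \<Rightarrow> complex) \<Rightarrow>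
     (complex \<Rightarrow> complex \<Rightarrow> complex) \<Rightarrow> bool" where
  "H1_conv B F u G \<longleftrightarrow> L2_conv (lebesgue_on B) F u \<and>
     (\<forall>e\<in>Basis. L2_conv (lebesgue_on B) (\<lambda>k x. frechet_derivative (F k) (at x) e) (G e))"

definition sobolev_H10 ::
    "complex set \<Rightarrow> (complex \<Rightarrow> complex) \<Rightarrow> (complex \<Rightarrow> complex \<Rightarrow> complex) \<Rightarrow> bool" where
  "sobolev_H10 B u G \<longleftrightarrow> sobolev_H1 B u G \<and>
     (\<exists>F. (\<forall>k. C1_compact_support B (F k)) \<and> H1_conv B F u G)"

text \<open>
  The boundary trace is the continuous extension of the restriction map from functions that are
  smooth up to the boundary.
\<close>
definition has_trace ::
    "complex set \<Rightarrow> (complex \<Rightarrow> complex) \<Rightarrow> (complex \<Rightarrow> complex \<Rightarrow> complex) \<Rightarrow>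
     (complex \<Rightarrow> complex) \<Rightarrow> bool" where
  "has_trace B u G t \<longleftrightarrow> sobolev_H1 B u G \<and> t \<in> L2 (bdry B) \<and>
     (\<exists>F. (\<forall>k. C1 (F k)) \<and> H1_conv B F u G \<and> L2_conv (bdry B) F t)"

text \<open>
  The Sobolev space of order one on the boundary is the completion of the restrictions of smooth
  functions for the norm that involves the function and its tangential derivative.
\<close>
definition has_tangential_deriv ::
    "complex set \<Rightarrow> (complex \<Rightarrow> complex) \<Rightarrow> (complex \<Rightarrow> complex) \<Rightarrow> bool" where
  "has_tangential_deriv B f g \<longleftrightarrow> f \<in> L2 (bdry B) \<and> g \<in> L2 (bdry B) \<and>
     (\<exists>F. (\<forall>k. C1 (F k)) \<and> L2_conv (bdry B) F f \<and>
        L2_conv (bdry B) (\<lambda>k. tangential_deriv B (F k)) g)"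

definition H1_bdry :: "complex set \<Rightarrow> (complex \<Rightarrow> complex) set" where
  "H1_bdry B = {f. \<exists>g. has_tangential_deriv B f g}"

text \<open>
  On a Lipschitz boundary \<open>g\<close> is determined almost everywhere by \<open>f\<close>, so the infimum is taken over
  a single number.
\<close>
definition H1_bdry_norm :: "complex set \<Rightarrow> (complex \<Rightarrow> complex) \<Rightarrow> real" where
  "H1_bdry_norm B f =
     (INF g\<in>{g. has_tangential_deriv B f g}. sqrt ((L2_norm (bdry B) f)\<^sup>2 + (L2_norm (bdry B) g)\<^sup>2))"

subsection \<open>Boundary value problems on the domain\<close>

text \<open>The weak eigenvalue problem for the operator \<open>- (1 / \<mu>) div ((1 / \<sigma>) grad u)\<close>.\<close>
definition neumann_eigenvalue ::
    "complex set \<Rightarrow> (complex \<Rightarrow> real) \<Rightarrow> (complex \<Rightarrow> real) \<Rightarrow> real \<Rightarrow> bool" where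
  "neumann_eigenvalue B \<sigma> \<mu> lam \<longleftrightarrow>
     (\<exists>u G. sobolev_H1 B u G \<and> \<not> (AE x in lebesgue_on B. u x = 0) \<and>
       (\<forall>v H. sobolev_H1 B v H \<longrightarrow>
          (\<integral>x. of_real (1 / \<sigma> x) * (\<Sum>e\<in>Basis. G e x * H e x) \<partial>lebesgue_on B)
            = of_real lam * (\<integral>x. of_real (\<mu> x) * u x * v x \<partial>lebesgue_on B)))"

definition dirichlet_eigenvalue :: "complex set \<Rightarrow> real \<Rightarrow> bool" where
  "dirichlet_eigenvalue B lam \<longleftrightarrow>
     (\<exists>u G. sobolev_H10 B u G \<and> \<not> (AE x in lebesgue_on B. u x = 0) \<and>
       (\<forall>v H. sobolev_H10 B v H \<longrightarrow>
          (\<integral>x. (\<Sum>e\<in>Basis. G e x * H e x) \<partial>lebesgue_on B)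
            = of_real lam * (\<integral>x. u x * v x \<partial>lebesgue_on B)))"

text \<open>
  Weak solutions \<open>w\<close>, with weak gradient \<open>G\<close>, of \<open>div ((1 / \<sigma>) grad w) + \<omega>\<^sup>2 \<mu> w = 0\<close> in \<open>B\<close>
  with conormal derivative \<open>g\<close> on the boundary.
\<close>
definition neumann_solution ::
    "complex set \<Rightarrow> (complex \<Rightarrow> real) \<Rightarrow> (complex \<Rightarrow> real) \<Rightarrow> real \<Rightarrow> (complex \<Rightarrow> complex) \<Rightarrow>
     (complex \<Rightarrow> complex) \<Rightarrow> (complex \<Rightarrow> complex \<Rightarrow> complex) \<Rightarrow> bool" where
  "neumann_solution B \<sigma> \<mu> \<omega> g w G \<longleftrightarrow> sobolev_H1 B w G \<and>
     (\<forall>v H t. has_trace B v H t \<longrightarrow>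
        (\<integral>x. of_real (1 / \<sigma> x) * (\<Sum>e\<in>Basis. G e x * H e x) \<partial>lebesgue_on B)
          - of_real (\<omega>\<^sup>2) * (\<integral>x. of_real (\<mu> x) * w x * v x \<partial>lebesgue_on B)
          = (\<integral>y. g y * t y \<partial>bdry B))"

text \<open>The Neumann-to-Dirichlet map; its values are determined up to null sets of the boundary.\<close>
definition NtD ::
    "complex set \<Rightarrow> (complex \<Rightarrow> real) \<Rightarrow> (complex \<Rightarrow> real) \<Rightarrow> real \<Rightarrow>
     (complex \<Rightarrow> complex) \<Rightarrow> complex \<Rightarrow> complex" where
  "NtD B \<sigma> \<mu> \<omega> g = (SOME t. \<exists>w G. neumann_solution B \<sigma> \<mu> \<omega> g w G \<and> has_trace B w G t)"

subsection \<open>Layer potentials and the scattering system\<close>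

definition single_layer ::
    "complex set \<Rightarrow> real \<Rightarrow> (complex \<Rightarrow> complex) \<Rightarrow> complex \<Rightarrow> complex" where
  "single_layer B \<omega> \<phi> x = (\<integral>y. fund_sol \<omega> (x - y) * \<phi> y \<partial>bdry B)"

definition NP_adjoint ::
    "complex set \<Rightarrow> real \<Rightarrow> (complex \<Rightarrow> complex) \<Rightarrow> complex \<Rightarrow> complex" where
  "NP_adjoint B \<omega> \<phi> x =
     Lim (at_right 0) (\<lambda>\<epsilon>. \<integral>y. (if \<epsilon> < dist x y
        then frechet_derivative (fund_sol \<omega>) (at (x - y)) (outward_normal B x) * \<phi> y else 0) \<partial>bdry B)"

definition scat_op ::
    "complex set \<Rightarrow> (complex \<Rightarrow> real) \<Rightarrow> (complex \<Rightarrow> real) \<Rightarrow> real \<Rightarrow>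
     (complex \<Rightarrow> complex) \<times> (complex \<Rightarrow> complex) \<Rightarrow> (complex \<Rightarrow> complex) \<times> (complex \<Rightarrow> complex)" where
  "scat_op B \<sigma> \<mu> \<omega> = (\<lambda>(\<phi>, \<psi>).
     (\<lambda>x. - single_layer B \<omega> \<phi> x + NtD B \<sigma> \<mu> \<omega> \<psi> x,
      \<lambda>x. - (\<phi> x / 2 + NP_adjoint B \<omega> \<phi> x) + \<psi> x))"

definition AE_eq_pair ::
    "complex set \<Rightarrow> (complex \<Rightarrow> complex) \<times> (complex \<Rightarrow> complex) \<Rightarrow>
     (complex \<Rightarrow> complex) \<times> (complex \<Rightarrow> complex) \<Rightarrow> bool" where
  "AE_eq_pair B p q \<longleftrightarrow>
     (AE x in bdry B. fst p x = fst q x) \<and> (AE x in bdry B. snd p x = snd q x)"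

text \<open>
  Invertibility between the Hilbert spaces \<open>L2 \<times> L2\<close> and \<open>H1 \<times> L2\<close>, whose elements
  are classes of functions modulo null sets of the boundary: the operator is well defined, bounded,
  bijective, and has a bounded inverse.
\<close>
definition scat_op_invertible ::
    "complex set \<Rightarrow> (complex \<Rightarrow> real) \<Rightarrow> (complex \<Rightarrow> real) \<Rightarrow> real \<Rightarrow> bool" where
  "scat_op_invertible B \<sigma> \<mu> \<omega> \<longleftrightarrow>
     (let X = L2 (bdry B) \<times> L2 (bdry B);
          Y = H1_bdry B \<times> L2 (bdry B);
          normX = (\<lambda>(f, g). L2_norm (bdry B) f + L2_norm (bdry B) g);
          normY = (\<lambda>(f, g). H1_bdry_norm B f + L2_norm (bdry B) g);
          A = scat_op B \<sigma> \<mu> \<omega>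
      in (\<forall>p\<in>X. A p \<in> Y) \<and>
         (\<exists>C. \<forall>p\<in>X. normY (A p) \<le> C * normX p) \<and>
         (\<forall>p\<in>X. \<forall>q\<in>X. AE_eq_pair B (A p) (A q) \<longleftrightarrow> AE_eq_pair B p q) \<and>
         (\<forall>q\<in>Y. \<exists>p\<in>X. AE_eq_pair B (A p) q) \<and>
         (\<exists>C. \<forall>p\<in>X. normX p \<le> C * normY (A p)))"

definition scat_density ::
    "complex set \<Rightarrow> (complex \<Rightarrow> real) \<Rightarrow> (complex \<Rightarrow> real) \<Rightarrow> real \<Rightarrow> int \<Rightarrow>
     (complex \<Rightarrow> complex) \<times> (complex \<Rightarrow> complex)" where
  "scat_density B \<sigma> \<mu> \<omega> m =
     (SOME p. p \<in> L2 (bdry B) \<times> L2 (bdry B) \<and>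
        AE_eq_pair B (scat_op B \<sigma> \<mu> \<omega> p) (cyl_wave \<omega> m, normal_deriv B (cyl_wave \<omega> m)))"

definition scat_coeff ::
    "complex set \<Rightarrow> (complex \<Rightarrow> real) \<Rightarrow> (complex \<Rightarrow> real) \<Rightarrow> real \<Rightarrow> int \<Rightarrow> int \<Rightarrow> complex" where
  "scat_coeff B \<sigma> \<mu> \<omega> n m =
     (\<integral>y. cnj (cyl_wave \<omega> n y) * fst (scat_density B \<sigma> \<mu> \<omega> m) y \<partial>bdry B)"

definition far_field ::
    "complex set \<Rightarrow> (complex \<Rightarrow> real) \<Rightarrow> (complex \<Rightarrow> real) \<Rightarrow> real \<Rightarrow> real \<Rightarrow> real \<Rightarrow> complex" where
  "far_field B \<sigma> \<mu> \<omega> \<theta>\<xi> \<theta>x =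
     (\<Sum>\<^sub>\<infinity>m::int. cis (of_int m * (pi / 2 - \<theta>\<xi>)) *
        (\<integral>y. cis (- \<omega> * norm y * cos (\<theta>x - Arg y)) * fst (scat_density B \<sigma> \<mu> \<omega> m) y \<partial>bdry B))"

end

theory Submission
  imports Defs
begin

text \<open>
  The integrand of the far-field pattern is a plane wave in \<open>y\<close>, and by the Jacobi-Anger expansion
  (\<open>plane_wave_expansion\<close>) it is the series
  \<open>\<Sum>n. e\<^bsup>in(\<theta> - \<pi>/2)\<^esup> cnj (C\<^sub>n y)\<close> of conjugated cylindrical waves. Integrating this against the density
  \<open>\<phi>\<^sub>m\<close> term by term gives \<open>\<Sum>n. e\<^bsup>in(\<theta> - \<pi>/2)\<^esup> W\<^sub>n\<^sub>m\<close>, and summing over \<open>m\<close> gives the theorem as an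
  iterated sum. What has to be justified is the exchange of sum and integral, and the passage from the
  iterated sum to an unconditionally convergent double sum. Both follow from a bound
  \<open>\<bar>W\<^sub>n\<^sub>m\<bar> \<le> C P\<^sub>n P\<^sub>m\<close> with \<open>P\<^sub>n = b\<^bsup>\<bar>n\<bar>\<^esup> / \<bar>n\<bar>!\<close>.
  
  On the bounded set \<open>\<partial>B\<close> the cylindrical waves and their gradients are at most a constant times \<open>P\<^sub>n\<close>
  (\<open>norm_cyl_wave_le\<close>, \<open>norm_cyl_wave_derivative_le\<close>), by the power series of the Bessel functions. Since the
  boundary has finite length (\<open>finite_measure_bdry\<close>), the same holds for the norms of their boundary
  data in \<open>H\<^sup>1(\<partial>B) \<times> L\<^sup>2(\<partial>B)\<close>, and the bounded inverse of the scattering operator carries the bound over to the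
  \<open>L\<^sup>2\<close> norm of the density \<open>\<phi>\<^sub>m\<close> (\<open>scat_density_L2_bound\<close>).
  
  For the boundary data to be elements of these spaces at all, the normal and tangential
  derivatives must be measurable, which requires the outward normal to be a Borel function
  (\<open>borel_measurable_outward_normal\<close>).
\<close>

section \<open>Termwise integration\<close>

text \<open>
  By the Weierstrass test the series converges uniformly, and integration against a fixed integrable
  function is continuous for uniform convergence.
\<close>
lemma has_sum_integral_uniform:
  fixes f :: "'i \<Rightarrow> 'a \<Rightarrow> complex" and \<phi> :: "'a \<Rightarrow> complex"
  assumes \<phi>: "integrable M \<phi>"
    and f: "\<And>n. f n \<in> borel_measurable M" and S: "S \<in> borel_measurable M"
    and sum: "\<And>y. y \<in> space M \<Longrightarrow> ((\<lambda>n. f n y) has_sum S y) UNIV"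
    and le: "\<And>n y. y \<in> space M \<Longrightarrow> norm (f n y) \<le> b n" and b: "b summable_on UNIV"
  shows "((\<lambda>n. \<integral>y. f n y * \<phi> y \<partial>M) has_sum (\<integral>y. S y * \<phi> y \<partial>M)) UNIV"
proof -
  have bounded: "integrable M (\<lambda>y. g y * \<phi> y)"
    if "g \<in> borel_measurable M" "\<And>y. y \<in> space M \<Longrightarrow> norm (g y) \<le> c" for g c
  proof (rule Bochner_Integration.integrable_bound)
    show "integrable M (\<lambda>y. c * norm (\<phi> y))"
      by (intro integrable_mult_right integrable_norm \<phi>)
    show "AE y in M. norm (g y * \<phi> y) \<le> norm (c * norm (\<phi> y))"
    proof (rule AE_I2)
      fix y assume "y \<in> space M"
      then have "norm (g y) * norm (\<phi> y) \<le> c * norm (\<phi> y)"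
        by (intro mult_right_mono that(2) norm_ge_zero)
      then show "norm (g y * \<phi> y) \<le> norm (c * norm (\<phi> y))"
        unfolding norm_mult real_norm_def by linarith
    qed
    show "(\<lambda>y. g y * \<phi> y) \<in> borel_measurable M"
      by (intro borel_measurable_times that(1) borel_measurable_integrable \<phi>)
  qed
  have fint: "integrable M (\<lambda>y. f n y * \<phi> y)" for n
    by (rule bounded[OF f le])
  have unif: "uniform_limit (space M) (\<lambda>F y. \<Sum>n\<in>F. f n y) S (finite_subsets_at_top UNIV)"
    by (rule Weierstrass_m_test_general'[OF le sum b])
  define I where "I = (\<integral>y. norm (\<phi> y) \<partial>M)"
  have I: "0 \<le> I" unfolding I_def by simp
  have key: "dist (\<Sum>n\<in>F. \<integral>y. f n y * \<phi> y \<partial>M) (\<integral>y. S y * \<phi> y \<partial>M) \<le> \<epsilon> * I"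
    if close: "\<forall>y\<in>space M. dist (\<Sum>n\<in>F. f n y) (S y) < \<epsilon>" for F \<epsilon>
  proof -
    have dint: "integrable M (\<lambda>y. ((\<Sum>n\<in>F. f n y) - S y) * \<phi> y)"
    proof (rule bounded)
      show "(\<lambda>y. (\<Sum>n\<in>F. f n y) - S y) \<in> borel_measurable M"
        by (intro borel_measurable_diff borel_measurable_sum f S)
      show "norm ((\<Sum>n\<in>F. f n y) - S y) \<le> \<epsilon>" if "y \<in> space M" for y
        using close that by (simp add: dist_norm less_imp_le)
    qed
    have sint: "integrable M (\<lambda>y. \<Sum>n\<in>F. f n y * \<phi> y)"
      by (rule Bochner_Integration.integrable_sum[OF fint])
    have "(\<lambda>y. S y * \<phi> y) = (\<lambda>y. (\<Sum>n\<in>F. f n y * \<phi> y) - ((\<Sum>n\<in>F. f n y) - S y) * \<phi> y)"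
      by (rule ext) (simp add: left_diff_distrib sum_distrib_right)
    then have "(\<integral>y. S y * \<phi> y \<partial>M) = (\<integral>y. (\<Sum>n\<in>F. f n y * \<phi> y) \<partial>M) - (\<integral>y. ((\<Sum>n\<in>F. f n y) - S y) * \<phi> y \<partial>M)"
      using Bochner_Integration.integral_diff[OF sint dint] by simp
    then have "dist (\<Sum>n\<in>F. \<integral>y. f n y * \<phi> y \<partial>M) (\<integral>y. S y * \<phi> y \<partial>M)
        = norm (\<integral>y. ((\<Sum>n\<in>F. f n y) - S y) * \<phi> y \<partial>M)"
      using fint by (simp add: dist_norm)
    also have "\<dots> \<le> (\<integral>y. norm (((\<Sum>n\<in>F. f n y) - S y) * \<phi> y) \<partial>M)"
      by (rule integral_norm_bound)
    also have "\<dots> \<le> (\<integral>y. \<epsilon> * norm (\<phi> y) \<partial>M)"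
    proof (rule integral_mono)
      show "integrable M (\<lambda>y. norm (((\<Sum>n\<in>F. f n y) - S y) * \<phi> y))"
        using dint by (rule integrable_norm)
      show "integrable M (\<lambda>y. \<epsilon> * norm (\<phi> y))"
        by (intro integrable_mult_right integrable_norm \<phi>)
      show "norm (((\<Sum>n\<in>F. f n y) - S y) * \<phi> y) \<le> \<epsilon> * norm (\<phi> y)" if "y \<in> space M" for y
        unfolding norm_mult using close that
        by (intro mult_right_mono norm_ge_zero) (simp add: dist_norm less_imp_le)
    qed
    finally show ?thesis by (simp add: I_def)
  qed
  show ?thesis
    unfolding has_sum_def
  proof (rule tendstoI)
    fix \<epsilon> :: real assume "0 < \<epsilon>"
    then have \<epsilon>: "0 < \<epsilon> / (I + 1)" using I by simp
    have "\<epsilon> / (I + 1) * I < \<epsilon>" using I \<open>0 < \<epsilon>\<close> by (simp add: field_simps)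
    then show "\<forall>\<^sub>F F in finite_subsets_at_top UNIV.
        dist (\<Sum>n\<in>F. \<integral>y. f n y * \<phi> y \<partial>M) (\<integral>y. S y * \<phi> y \<partial>M) < \<epsilon>"
      by (intro eventually_mono[OF uniform_limitD[OF unif \<epsilon>]] le_less_trans[OF key])
  qed
qed

section \<open>Finite length of a Lipschitz boundary\<close>

text \<open>
  Only the finiteness of the arclength of the boundary is used later, so it suffices to exhibit, at every
  scale, covers by small sets with uniformly bounded total diameter. Finite lists of sets make unions of
  covers a concatenation.
\<close>
definition finite_length_covers :: "complex set \<Rightarrow> bool" where
  "finite_length_covers A \<longleftrightarrow> (\<exists>C. \<forall>\<delta>>0. \<exists>Es. A \<subseteq> \<Union> (set Es) \<and>
     (\<forall>E\<in>set Es. bounded E \<and> diameter E \<le> \<delta>) \<and> sum_list (map diameter Es) \<le> C)"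

lemma hausdorff1_finite:
  assumes "finite_length_covers A"
  shows "hausdorff1 A < \<infinity>"
proof -
  obtain C where C: "\<And>\<delta>. 0 < \<delta> \<Longrightarrow> \<exists>Es. A \<subseteq> \<Union> (set Es) \<and>
     (\<forall>E\<in>set Es. bounded E \<and> diameter E \<le> \<delta>) \<and> sum_list (map diameter Es) \<le> C"
    using assms unfolding finite_length_covers_def by blast
  have "hausdorff1 A \<le> ennreal C"
    unfolding hausdorff1_def
  proof (rule SUP_least)
    fix \<delta> :: real assume "\<delta> \<in> {0<..}"
    then have "0 < \<delta>" by simp
    then obtain Es where Es: "A \<subseteq> \<Union> (set Es)" "\<forall>E\<in>set Es. bounded E \<and> diameter E \<le> \<delta>"
      "sum_list (map diameter Es) \<le> C"
      using C by blast
    define E where "E i = (if i < length Es then Es ! i else {})" for i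
    have cov: "A \<subseteq> (\<Union>i. E i)"
    proof
      fix x assume "x \<in> A"
      then obtain S where "S \<in> set Es" "x \<in> S" using Es(1) by auto
      then obtain i where "i < length Es" "Es ! i = S" by (auto simp: in_set_conv_nth)
      then show "x \<in> (\<Union>i. E i)" using \<open>x \<in> S\<close> by (auto simp: E_def intro!: exI[of _ i])
    qed
    have small: "bounded (E i) \<and> diameter (E i) \<le> \<delta>" for i
      using Es(2) \<open>0 < \<delta>\<close> by (auto simp: E_def)
    have "(\<Sum>i. ennreal (diameter (E i))) = (\<Sum>i<length Es. ennreal (diameter (E i)))"
      by (rule suminf_finite) (auto simp: E_def)
    also have "\<dots> = ennreal (\<Sum>i<length Es. diameter (E i))"
      using small by (intro sum_ennreal) (auto intro: diameter_ge_0)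
    also have "(\<Sum>i<length Es. diameter (E i)) = sum_list (map diameter Es)"
      by (simp add: sum_list_sum_nth atLeast0LessThan E_def)
    finally have "(\<Sum>i. ennreal (diameter (E i))) \<le> ennreal C"
      using Es(3) by (simp add: ennreal_leI)
    then show "(INF E\<in>{E :: nat \<Rightarrow> complex set.
          A \<subseteq> (\<Union>i. E i) \<and> (\<forall>i. bounded (E i) \<and> diameter (E i) \<le> \<delta>)}.
        (\<Sum>i. ennreal (diameter (E i)))) \<le> ennreal C"
      using cov small by (intro INF_lower2[of E]) auto
  qed
  then show ?thesis
    using ennreal_less_top le_less_trans by fastforce
qed

lemma finite_length_covers_empty: "finite_length_covers {}"
  unfolding finite_length_covers_def by (auto intro!: exI[of _ 0] exI[of _ "[]"])

lemma finite_length_covers_subset: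
  "finite_length_covers A \<Longrightarrow> A' \<subseteq> A \<Longrightarrow> finite_length_covers A'"
  unfolding finite_length_covers_def by (meson subset_trans)

lemma finite_length_covers_Un:
  assumes "finite_length_covers A" "finite_length_covers A'"
  shows "finite_length_covers (A \<union> A')"
proof -
  let ?P = "\<lambda>A C \<delta> Es. A \<subseteq> \<Union> (set Es) \<and>
     (\<forall>E\<in>set Es. bounded E \<and> diameter E \<le> \<delta>) \<and> sum_list (map diameter Es) \<le> (C::real)"
  obtain C C' where C: "\<And>\<delta>. 0 < \<delta> \<Longrightarrow> \<exists>Es. ?P A C \<delta> Es" "\<And>\<delta>. 0 < \<delta> \<Longrightarrow> \<exists>Es. ?P A' C' \<delta> Es"
    using assms unfolding finite_length_covers_def by blast
  have "\<exists>Es. ?P (A \<union> A') (C + C') \<delta> Es" if \<delta>: "0 < \<delta>" for \<delta> :: real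
  proof -
    obtain Es Es' where "?P A C \<delta> Es" "?P A' C' \<delta> Es'" using C[OF \<delta>] by blast
    then have "?P (A \<union> A') (C + C') \<delta> (Es @ Es')" by auto
    then show ?thesis by blast
  qed
  then show ?thesis unfolding finite_length_covers_def by blast
qed

lemma finite_length_covers_UN:
  "finite I \<Longrightarrow> (\<And>i. i \<in> I \<Longrightarrow> finite_length_covers (A i)) \<Longrightarrow> finite_length_covers (\<Union>i\<in>I. A i)"
  by (induction I rule: finite_induct)
     (auto intro: finite_length_covers_empty finite_length_covers_Un)

text \<open>
  Cutting the parameter interval into \<open>N\<close> equal pieces of length \<open>h\<close> gives pieces of the arc of
  diameter at most \<open>L h\<close>; the total \<open>N L h = L (b - a)\<close> does not depend on \<open>N\<close>.
\<close>
lemma finite_length_covers_lipschitz_arc: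
  fixes g :: "real \<Rightarrow> complex"
  assumes g: "lipschitz_on L UNIV g" and "a < b"
  shows "finite_length_covers (g ` {a..b})"
proof -
  have L: "0 \<le> L" using g by (rule lipschitz_on_nonneg)
  have "\<exists>Es. g ` {a..b} \<subseteq> \<Union> (set Es) \<and> (\<forall>E\<in>set Es. bounded E \<and> diameter E \<le> \<delta>) \<and>
      sum_list (map diameter Es) \<le> L * (b - a)" if \<delta>: "0 < \<delta>" for \<delta>
  proof -
    obtain N :: nat where N: "L * (b - a) / \<delta> < N" using reals_Archimedean2 by blast
    have N0: "0 < N"
      using N L \<open>a < b\<close> \<delta> by (metis diff_gt_0_iff_gt divide_nonneg_pos less_le_not_le
          mult_nonneg_nonneg of_nat_0_less_iff order.strict_implies_order order_le_less_trans)
    define h where "h = (b - a) / N"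
    have h: "0 < h" using N0 \<open>a < b\<close> by (simp add: h_def)
    define E where "E i = g ` {a + of_nat i * h..a + of_nat (Suc i) * h}" for i :: nat
    have diam: "diameter (E i) \<le> L * h" for i
    proof (rule diameter_le)
      show "E i \<noteq> {} \<or> 0 \<le> L * h" using L h by simp
      fix x y assume "x \<in> E i" "y \<in> E i"
      then obtain s t where st: "s \<in> {a + of_nat i * h..a + of_nat (Suc i) * h}"
        "t \<in> {a + of_nat i * h..a + of_nat (Suc i) * h}" "x = g s" "y = g t"
        by (auto simp: E_def)
      have "norm (x - y) \<le> L * \<bar>s - t\<bar>"
        using lipschitz_on_normD[OF g] st by auto
      also have "\<dots> \<le> L * h"
        using st L by (intro mult_left_mono) (auto simp: algebra_simps abs_le_iff)
      finally show "norm (x - y) \<le> L * h" .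
    qed
    have bdd: "bounded (E i)" for i
      unfolding E_def using lipschitz_on_continuous_on[OF g]
      by (intro compact_imp_bounded compact_continuous_image) (auto intro: continuous_on_subset)
    have "L * h \<le> \<delta>"
      using N N0 \<delta> by (simp add: h_def field_simps)
    have cov: "g ` {a..b} \<subseteq> (\<Union>i<N. E i)"
    proof
      fix x assume "x \<in> g ` {a..b}"
      then obtain s where s: "a \<le> s" "s \<le> b" "x = g s" by auto
      show "x \<in> (\<Union>i<N. E i)"
      proof (cases "s = b")
        case True
        \<comment> \<open>The right end point is not caught by the floor below; it lies in the last piece.\<close>
        have "a + of_nat (Suc (N - 1)) * h = b" using N0 by (simp add: h_def)
        then have "x \<in> E (N - 1)" 
          unfolding E_def s(3) True using h N0 by (intro imageI) (auto simp: of_nat_diff algebra_simps)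
        then show ?thesis using N0 by (intro UN_I[of "N - 1"]) auto
      next
        case False
        define i where "i = nat \<lfloor>(s - a) / h\<rfloor>"
        have i1: "of_nat i \<le> (s - a) / h" "(s - a) / h < of_nat i + 1"
          using s h unfolding i_def by (auto simp: le_nat_floor)
        have "(s - a) / h < N"
          using s False h N0 \<open>a < b\<close> by (simp add: h_def field_simps)
        then have "i < N" using i1 by linarith
        moreover have "x \<in> E i"
          unfolding E_def s(3) using i1 h by (intro imageI) (auto simp: field_simps)
        ultimately show ?thesis by blast
      qed
    qed
    have "sum_list (map diameter (map E [0..<N])) \<le> L * (b - a)"
    proof -
      have "sum_list (map diameter (map E [0..<N])) = (\<Sum>i<N. diameter (E i))"
        by (simp add: sum_list_distinct_conv_sum_set atLeast0LessThan o_def)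
      also have "\<dots> \<le> (\<Sum>i<N. L * h)" by (intro sum_mono diam)
      finally show ?thesis using N0 by (simp add: h_def)
    qed
    moreover have "\<forall>E\<in>set (map E [0..<N]). bounded E \<and> diameter E \<le> \<delta>"
      using bdd diam \<open>L * h \<le> \<delta>\<close> by (auto intro: order_trans)
    moreover have "g ` {a..b} \<subseteq> \<Union> (set (map E [0..<N]))"
      using cov by (simp add: atLeast0LessThan)
    ultimately show ?thesis by blast
  qed
  then show ?thesis unfolding finite_length_covers_def by blast
qed

text \<open>
  Strictly above the graph a point of the chart is inside the open set \<open>B\<close>, and strictly below it has a
  neighbourhood that misses \<open>B\<close>; both exclude boundary points.
\<close>
lemma frontier_in_graph:
  assumes "open B" "norm u = 1" and cont: "continuous_on UNIV \<gamma>"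
    and chart: "B \<inter> ball p r = {x \<in> ball p r. \<gamma> (Re ((x - p) * cnj u)) < Im ((x - p) * cnj u)}"
  shows "frontier B \<inter> ball p r \<subseteq> (\<lambda>s. p + u * Complex s (\<gamma> s)) ` {-r..r}"
proof
  fix x assume x: "x \<in> frontier B \<inter> ball p r"
  define s where "s = Re ((x - p) * cnj u)"
  have uu: "u * cnj u = 1" using \<open>norm u = 1\<close> by (simp add: complex_norm_square[symmetric])
  have "x \<notin> B" using x \<open>open B\<close> by (simp add: frontier_def interior_open)
  then have "\<not> \<gamma> s < Im ((x - p) * cnj u)" using chart x s_def by auto
  moreover have "\<not> Im ((x - p) * cnj u) < \<gamma> s"
  proof
    assume lt: "Im ((x - p) * cnj u) < \<gamma> s"
    have "open {y. Im ((y - p) * cnj u) < \<gamma> (Re ((y - p) * cnj u))}"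
      by (intro open_Collect_less continuous_on_compose2[OF cont] continuous_intros) auto
    then have "open ({y. Im ((y - p) * cnj u) < \<gamma> (Re ((y - p) * cnj u))} \<inter> ball p r)" (is "open ?U")
      by blast
    moreover have "x \<in> ?U" using lt x s_def by auto
    moreover have "x \<in> closure B" using x by (simp add: frontier_def)
    ultimately have "?U \<inter> B \<noteq> {}" using open_Int_closure_eq_empty[of ?U B] by blast
    then obtain y where "y \<in> ball p r" "y \<in> B" "Im ((y - p) * cnj u) < \<gamma> (Re ((y - p) * cnj u))"
      by blast
    moreover from this chart have "\<gamma> (Re ((y - p) * cnj u)) < Im ((y - p) * cnj u)"
      by blast
    ultimately show False by simp
  qed
  ultimately have im: "Im ((x - p) * cnj u) = \<gamma> s" by simp
  have "x = p + u * ((x - p) * cnj u)" using uu by (simp add: algebra_simps)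
  also have "(x - p) * cnj u = Complex s (\<gamma> s)" using im s_def by (simp add: complex_eq_iff)
  finally have "x = p + u * Complex s (\<gamma> s)" .
  moreover have "\<bar>s\<bar> \<le> r"
  proof -
    have "\<bar>s\<bar> \<le> norm ((x - p) * cnj u)" unfolding s_def by (rule abs_Re_le_cmod)
    also have "\<dots> \<le> r" using x \<open>norm u = 1\<close> by (simp add: norm_mult dist_norm norm_minus_commute)
    finally show ?thesis .
  qed
  ultimately show "x \<in> (\<lambda>s. p + u * Complex s (\<gamma> s)) ` {-r..r}" by (auto simp: abs_le_iff)
qed

lemma lipschitz_graph:
  assumes "norm u = 1" "lipschitz_on L UNIV \<gamma>"
  shows "lipschitz_on (1 + L) UNIV (\<lambda>s. p + u * Complex s (\<gamma> s))"
proof (rule lipschitz_onI)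
  fix s t :: real
  have "dist (p + u * Complex s (\<gamma> s)) (p + u * Complex t (\<gamma> t)) = norm (u * Complex (s - t) (\<gamma> s - \<gamma> t))"
    by (simp add: dist_norm algebra_simps flip: complex_diff)
  also have "\<dots> = norm (Complex (s - t) (\<gamma> s - \<gamma> t))" using assms(1) by (simp add: norm_mult)
  also have "\<dots> \<le> \<bar>s - t\<bar> + \<bar>\<gamma> s - \<gamma> t\<bar>"
    using cmod_le[of "Complex (s - t) (\<gamma> s - \<gamma> t)"] by simp
  also have "\<bar>\<gamma> s - \<gamma> t\<bar> \<le> L * \<bar>s - t\<bar>"
    using lipschitz_on_normD[OF assms(2), of s t] by simp
  finally show "dist (p + u * Complex s (\<gamma> s)) (p + u * Complex t (\<gamma> t)) \<le> (1 + L) * dist s t"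
    by (simp add: dist_real_def algebra_simps)
next
  show "0 \<le> 1 + L" using lipschitz_on_nonneg[OF assms(2)] by simp
qed

text \<open>
  By compactness finitely many charts cover the boundary, and in each of them it lies on a Lipschitz arc.
\<close>
lemma finite_length_covers_frontier:
  assumes "bounded B" "lipschitz_domain B"
  shows "finite_length_covers (frontier B)"
proof -
  have "open B" using assms(2) by (simp add: lipschitz_domain_def)
  have "\<exists>r>0. finite_length_covers (frontier B \<inter> ball p r)" if p: "p \<in> frontier B" for p
  proof -
    obtain u r L \<gamma> where "norm u = 1" "0 < r" "lipschitz_on L UNIV \<gamma>"
      and chart: "B \<inter> ball p r = {x \<in> ball p r. \<gamma> (Re ((x - p) * cnj u)) < Im ((x - p) * cnj u)}"
      using assms(2) p unfolding lipschitz_domain_def by meson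
    have "finite_length_covers ((\<lambda>s. p + u * Complex s (\<gamma> s)) ` {-r..r})"
      using lipschitz_graph[OF \<open>norm u = 1\<close> \<open>lipschitz_on L UNIV \<gamma>\<close>] \<open>0 < r\<close>
      by (intro finite_length_covers_lipschitz_arc) auto
    then have "finite_length_covers (frontier B \<inter> ball p r)"
      by (rule finite_length_covers_subset)
         (rule frontier_in_graph[OF \<open>open B\<close> \<open>norm u = 1\<close>
            lipschitz_on_continuous_on[OF \<open>lipschitz_on L UNIV \<gamma>\<close>] chart])
    with \<open>0 < r\<close> show ?thesis by blast
  qed
  then obtain r where r: "\<And>p. p \<in> frontier B \<Longrightarrow> 0 < r p"
    "\<And>p. p \<in> frontier B \<Longrightarrow> finite_length_covers (frontier B \<inter> ball p (r p))" by metis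
  have "compact (frontier B)" using assms(1) by (rule compact_frontier_bounded)
  then obtain P where P: "P \<subseteq> frontier B" "finite P" "frontier B \<subseteq> (\<Union>p\<in>P. ball p (r p))"
  proof (rule compactE_image)
    show "frontier B \<subseteq> (\<Union>p\<in>frontier B. ball p (r p))" using r(1) by force
  qed auto
  have "finite_length_covers (\<Union>p\<in>P. frontier B \<inter> ball p (r p))"
    using P r(2) by (intro finite_length_covers_UN) auto
  then show ?thesis by (rule finite_length_covers_subset) (use P in auto)
qed

lemma sets_measure_of_borel: "sets (measure_of UNIV (sets borel) \<mu>) = sets borel"
  using sets.sigma_sets_eq[of borel] by (simp add: sets_measure_of_conv)

lemma space_bdry [simp]: "space (bdry B) = frontier B"
  by (auto simp: bdry_def space_restrict_space space_measure_of_conv)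

lemma borel_measurable_bdry: "f \<in> borel_measurable borel \<Longrightarrow> f \<in> borel_measurable (bdry B)"
  unfolding bdry_def using sets_measure_of_borel[of hausdorff1]
  by (intro measurable_restrict_space1 measurable_completion) (simp cong: measurable_cong_sets)

text \<open>
  The measure built from the Hausdorff outer measure is either that outer measure on the Borel sets or
  the null measure, depending on whether the outer measure is countably additive there. An upper bound for
  the outer measure bounds the measure in both cases.
\<close>
lemma finite_measure_bdry:
  assumes "bounded B" "lipschitz_domain B"
  shows "finite_measure (bdry B)"
proof -
  let ?M = "measure_of UNIV (sets borel) hausdorff1"
  have sets: "frontier B \<in> sets ?M"
    by (simp add: sets_measure_of_borel)
  have "emeasure (bdry B) (space (bdry B)) = emeasure (completion ?M) (frontier B)"
    unfolding bdry_def using sets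
    by (subst emeasure_restrict_space) (auto simp: space_restrict_space space_measure_of_conv)
  also have "\<dots> = emeasure ?M (frontier B)" using sets by simp
  also have "\<dots> \<le> hausdorff1 (frontier B)"
    by (auto simp: emeasure_measure_of_conv)
  also have "\<dots> < \<infinity>"
    using finite_length_covers_frontier[OF assms] by (rule hausdorff1_finite)
  finally show ?thesis by (intro finite_measureI) auto
qed

section \<open>Measurability of the outward normal\<close>

text \<open>
  If there were two normals \<open>n\<close> and \<open>n'\<close>, the direction \<open>n - n'\<close> would point strictly outward for the first
  and strictly inward for the second: near the base point, an open cone around it would miss \<open>B\<close> and yet
  contain points of its closure.
\<close>
lemma is_outward_normal_unique:
  assumes "is_outward_normal B x n" "is_outward_normal B x n'"
  shows "n = n'"
proof (rule ccontr)
  assume "n \<noteq> n'"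
  define h where "h = n - n'"
  have nn: "norm n = 1" "norm n' = 1" using assms by (auto simp: is_outward_normal_def)
  have "n \<bullet> n' < 1"
    using \<open>n \<noteq> n'\<close> nn norm_cauchy_schwarz[of n n'] norm_cauchy_schwarz_eq[of n n'] by fastforce
  then have h: "0 < h \<bullet> n" "h \<bullet> n' < 0" "h \<noteq> 0"
    using nn \<open>n \<noteq> n'\<close> by (auto simp: h_def inner_diff_left dot_square_norm inner_commute[of n' n])
  obtain \<epsilon> where \<epsilon>: "0 < \<epsilon>" "\<epsilon> * norm h < h \<bullet> n" "h \<bullet> n' < - \<epsilon> * norm h"
  proof
    let ?\<epsilon> = "min (h \<bullet> n) (- (h \<bullet> n')) / (2 * norm h)"
    show "0 < ?\<epsilon>" using h by simp
    show "?\<epsilon> * norm h < h \<bullet> n" "h \<bullet> n' < - ?\<epsilon> * norm h" using h by (auto simp: min_def)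
  qed
  obtain \<delta> where \<delta>: "0 < \<delta>"
    "\<And>k. norm k < \<delta> \<Longrightarrow> \<epsilon> * norm k < k \<bullet> n \<Longrightarrow> x + k \<notin> B"
    "\<And>k. norm k < \<delta> \<Longrightarrow> k \<bullet> n' < - \<epsilon> * norm k \<Longrightarrow> x + k \<in> closure B"
  proof -
    have "\<forall>\<^sub>F k in nhds 0. (\<epsilon> * norm k < k \<bullet> n \<longrightarrow> x + k \<notin> B) \<and> (k \<bullet> n' < - \<epsilon> * norm k \<longrightarrow> x + k \<in> closure B)"
      using assms \<epsilon>(1) unfolding is_outward_normal_def by (auto intro: eventually_elim2)
    then show ?thesis unfolding eventually_nhds_metric using that by auto
  qed
  define U where "U = {y. norm (y - x) < \<delta> \<and> \<epsilon> * norm (y - x) < (y - x) \<bullet> n}"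
  have "open U" unfolding U_def
    by (intro open_Collect_conj open_Collect_less continuous_intros)
  have "U \<inter> B = {}" using \<delta>(2)[of "y - x" for y] by (auto simp: U_def)
  then have "U \<inter> closure B = {}" using \<open>open U\<close> open_Int_closure_eq_empty by blast
  moreover define t where "t = \<delta> / (2 * norm h)"
  have "0 < t" using \<delta>(1) h by (simp add: t_def)
  have "x + t *\<^sub>R h \<in> U"
    using h \<delta>(1) \<epsilon> \<open>0 < t\<close> unfolding U_def by (simp add: mult.left_commute) (simp add: t_def)
  moreover have "t * (h \<bullet> n') < t * (- \<epsilon> * norm h)"
    using \<epsilon>(3) \<open>0 < t\<close> by (rule mult_strict_left_mono)
  then have "x + t *\<^sub>R h \<in> closure B"
    using h \<open>0 < t\<close> \<delta>(1) by (intro \<delta>(3)) (simp add: t_def, simp add: mult.left_commute)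
  ultimately show False by blast
qed

text \<open>
  The normality condition at a fixed aperture \<open>\<epsilon>\<close> and a fixed radius \<open>\<delta>\<close>. Unlike the limiting condition,
  it is closed in the pair of the base point and the vector.
\<close>
definition approx_normal :: "complex set \<Rightarrow> real \<Rightarrow> real \<Rightarrow> complex \<Rightarrow> complex \<Rightarrow> bool" where
  "approx_normal B \<epsilon> \<delta> x n \<longleftrightarrow> norm n = 1 \<and> (\<forall>h. norm h < \<delta> \<longrightarrow>
     (\<epsilon> * norm h < h \<bullet> n \<longrightarrow> x + h \<notin> B) \<and> (h \<bullet> n < - \<epsilon> * norm h \<longrightarrow> x + h \<in> closure B))"

lemma is_outward_normal_iff_approx:
  "is_outward_normal B x n \<longleftrightarrow> (\<forall>\<epsilon>>0. \<exists>\<delta>>0. approx_normal B \<epsilon> \<delta> x n)"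
  unfolding is_outward_normal_def approx_normal_def eventually_nhds_metric
  by (auto intro: zero_less_one)

lemma approx_normal_mono:
  "approx_normal B \<epsilon> \<delta> x n \<Longrightarrow> \<delta>' \<le> \<delta> \<Longrightarrow> approx_normal B \<epsilon> \<delta>' x n"
  unfolding approx_normal_def by auto

lemma approx_normal_perturb:
  assumes "approx_normal B \<epsilon> \<delta> x n" "norm n' = 1" "\<epsilon> + norm (n - n') \<le> \<epsilon>'"
  shows "approx_normal B \<epsilon>' \<delta> x n'"
  unfolding approx_normal_def
proof (intro conjI allI impI)
  fix h :: complex assume h: "norm h < \<delta>"
  have "\<bar>h \<bullet> n - h \<bullet> n'\<bar> \<le> norm h * norm (n - n')"
    using Cauchy_Schwarz_ineq2[of h "n - n'"] by (simp add: inner_diff_right)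
  also have "\<dots> \<le> norm h * (\<epsilon>' - \<epsilon>)" using assms(3) by (intro mult_left_mono) auto
  finally have *: "\<bar>h \<bullet> n - h \<bullet> n'\<bar> \<le> \<epsilon>' * norm h - \<epsilon> * norm h" by (simp add: algebra_simps)
  show "x + h \<notin> B" if "\<epsilon>' * norm h < h \<bullet> n'"
    using * that h assms(1) unfolding approx_normal_def by force
  show "x + h \<in> closure B" if "h \<bullet> n' < - \<epsilon>' * norm h"
    using * that h assms(1) unfolding approx_normal_def by force
qed (use assms in auto)

text \<open>
  Each of the conditions on a single increment \<open>h\<close> fails on an open set: \<open>B\<close> and the complement of its
  closure are open, and the cone conditions are strict inequalities.
\<close>
lemma closed_approx_normal:
  assumes "open B"
  shows "closed {(n, x). approx_normal B \<epsilon> \<delta> x n}"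
proof -
  have "{(n, x). approx_normal B \<epsilon> \<delta> x n} = {z. norm (fst z) = 1} \<inter>
      (\<Inter>h\<in>ball 0 \<delta>. {z. \<not> (\<epsilon> * norm h < h \<bullet> fst z \<and> snd z + h \<in> B)} \<inter>
                  {z. \<not> (h \<bullet> fst z < - \<epsilon> * norm h \<and> snd z + h \<notin> closure B)})"
    by (auto simp: approx_normal_def)
  moreover have "open {z :: complex \<times> complex. \<epsilon> * norm h < h \<bullet> fst z \<and> snd z + h \<in> B}" for h
  proof -
    have "open ((\<lambda>z::complex \<times> complex. snd z + h) -` B)"
      by (intro open_vimage assms continuous_intros)
    then show ?thesis
      by (intro open_Collect_conj open_Collect_less continuous_intros) (simp add: vimage_def)
  qed
  moreover have "open {z :: complex \<times> complex. h \<bullet> fst z < - \<epsilon> * norm h \<and> snd z + h \<notin> closure B}" for h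
  proof -
    have "open ((\<lambda>z::complex \<times> complex. snd z + h) -` (- closure B))"
      by (intro open_vimage continuous_intros) auto
    then show ?thesis
      by (intro open_Collect_conj open_Collect_less continuous_intros) (simp add: vimage_def)
  qed
  ultimately show ?thesis
    by (simp only:)
      (intro closed_Int closed_INT ballI closed_Collect_eq closed_Collect_neg continuous_intros)
qed

text \<open>
  For fixed aperture and radius, projecting the closed set of approximate normals along the compact set \<open>K\<close>
  gives a closed set, so the points that have approximate normals in \<open>K\<close> at every aperture form a Borel set
  after a countable union over radii and a countable intersection over apertures. The vector may depend on
  the aperture, but by compactness the approximate normals accumulate at some vector of \<open>K\<close>, which by
  \<open>approx_normal_perturb\<close> is a true normal.
\<close>
lemma borel_outward_normal_in:
  assumes "open B" "compact K"
  shows "{x. \<exists>n\<in>K. is_outward_normal B x n} \<in> sets borel"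
proof -
  define D where "D i j = {x. \<exists>n. n \<in> K \<and> approx_normal B (1 / Suc i) (1 / Suc j) x n}" for i j :: nat
  have "closed (D i j)" for i j
    using closed_compact_projection[OF assms(2) closed_approx_normal[OF assms(1)]] by (simp add: D_def)
  then have "(\<Inter>i. \<Union>j. D i j) \<in> sets borel"
    by (intro sets.countable_INT' sets.countable_UN') auto
  moreover have "{x. \<exists>n\<in>K. is_outward_normal B x n} = (\<Inter>i. \<Union>j. D i j)"
  proof (intro set_eqI iffI)
    fix x assume "x \<in> {x. \<exists>n\<in>K. is_outward_normal B x n}"
    then obtain n where n: "n \<in> K" "is_outward_normal B x n" by auto
    show "x \<in> (\<Inter>i. \<Union>j. D i j)"
    proof
      fix i :: nat
      have "0 < 1 / real (Suc i)" by simp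
      then obtain \<delta> where "0 < \<delta>" "approx_normal B (1 / Suc i) \<delta> x n"
        using n(2) unfolding is_outward_normal_iff_approx by blast
      moreover obtain j where "1 / real (Suc j) < \<delta>"
        using \<open>0 < \<delta>\<close> nat_approx_posE by blast
      ultimately have "x \<in> D i j" using n(1) approx_normal_mono unfolding D_def by (auto intro: less_imp_le)
      then show "x \<in> (\<Union>j. D i j)" by blast
    qed
  next
    fix x assume x: "x \<in> (\<Inter>i. \<Union>j. D i j)"
    have "\<exists>n j. n \<in> K \<and> approx_normal B (1 / Suc i) (1 / Suc j) x n" for i
      using x unfolding D_def by blast
    then obtain N J where NJ: "\<And>i. N i \<in> K" "\<And>i. approx_normal B (1 / Suc i) (1 / Suc (J i)) x (N i)"
      by metis
    obtain n r where n: "n \<in> K" "strict_mono r" "(N \<circ> r) \<longlonglongrightarrow> n"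
      using assms(2) NJ(1) unfolding compact_def by metis
    have "(\<lambda>i. norm ((N \<circ> r) i)) \<longlonglongrightarrow> norm n" using n(3) by (rule tendsto_norm)
    moreover have "norm ((N \<circ> r) i) = 1" for i using NJ(2) by (simp add: approx_normal_def)
    ultimately have n1: "norm n = 1" by (simp add: LIMSEQ_const_iff)
    have "\<exists>\<delta>>0. approx_normal B \<epsilon> \<delta> x n" if "0 < \<epsilon>" for \<epsilon> :: real
    proof -
      have "(\<lambda>i. 1 / real (Suc (r i)) + norm ((N \<circ> r) i - n)) \<longlonglongrightarrow> 0 + norm (n - n)"
        using n(3) LIMSEQ_subseq_LIMSEQ[OF LIMSEQ_Suc[OF lim_1_over_n] n(2)]
        by (intro tendsto_intros) (auto simp: o_def)
      then have "\<forall>\<^sub>F i in sequentially. 1 / real (Suc (r i)) + norm ((N \<circ> r) i - n) < \<epsilon>"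
        using \<open>0 < \<epsilon>\<close> by (intro order_tendstoD) auto
      then obtain i where "1 / real (Suc (r i)) + norm ((N \<circ> r) i - n) < \<epsilon>"
        using eventually_happens'[OF sequentially_bot] by blast
      then have "approx_normal B \<epsilon> (1 / Suc (J (r i))) x n"
        by (intro approx_normal_perturb[OF NJ(2)[of "r i"] n1]) auto
      then show ?thesis by (intro exI[of _ "1 / Suc (J (r i))"]) auto
    qed
    then show "x \<in> {x. \<exists>n\<in>K. is_outward_normal B x n}"
      using n(1) is_outward_normal_iff_approx by blast
  qed
  ultimately show ?thesis by simp
qed

lemma outward_normal_eqI: "is_outward_normal B x n \<Longrightarrow> outward_normal B x = n"
  unfolding outward_normal_def using is_outward_normal_unique by (auto intro!: the_equality)

lemma norm_outward_normal_le: "norm (outward_normal B x) \<le> 1"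
proof (cases "\<exists>n. is_outward_normal B x n")
  case True
  then obtain n where "is_outward_normal B x n" by blast
  then show ?thesis by (simp add: outward_normal_eqI) (simp add: is_outward_normal_def)
qed (simp add: outward_normal_def)

text \<open>
  The preimage of a closed set \<open>K\<close> consists of the points with a normal in \<open>K\<close>, together with all points
  without a normal in case \<open>K\<close> contains the default value \<open>0\<close>.
\<close>
lemma borel_measurable_outward_normal:
  assumes "open B"
  shows "outward_normal B \<in> borel_measurable borel"
proof (subst borel_eq_closed[where 'a = complex], rule measurable_measure_of)
  fix K :: "complex set" assume "K \<in> Collect closed"
  then have "closed K" by simp
  let ?N = "\<lambda>K. {x. \<exists>n\<in>K. is_outward_normal B x n}"
  have "?N (K \<inter> sphere 0 1) \<in> sets borel" "?N (sphere 0 1) \<in> sets borel"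
    using \<open>closed K\<close> by (auto intro!: borel_outward_normal_in[OF assms] closed_Int_compact)
  then have "?N (K \<inter> sphere 0 1) \<union> (if 0 \<in> K then - ?N (sphere 0 1) else {}) \<in> sets borel"
    by auto
  also have "?N (K \<inter> sphere 0 1) \<union> (if 0 \<in> K then - ?N (sphere 0 1) else {})
      = outward_normal B -` K \<inter> space borel"
  proof (intro set_eqI)
    fix x
    have S: "n \<in> sphere 0 1" if "is_outward_normal B x n" for n
      using that by (simp add: is_outward_normal_def)
    show "x \<in> ?N (K \<inter> sphere 0 1) \<union> (if 0 \<in> K then - ?N (sphere 0 1) else {}) \<longleftrightarrow>
        x \<in> outward_normal B -` K \<inter> space borel"
    proof (cases "\<exists>n. is_outward_normal B x n")
      case True
      then obtain n where n: "is_outward_normal B x n" by blast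
      then have "is_outward_normal B x n' \<longleftrightarrow> n' = n" for n'
        using is_outward_normal_unique[OF n] by blast
      then show ?thesis using S[OF n] outward_normal_eqI[OF n] by simp
    next
      case False
      then show ?thesis by (auto simp: outward_normal_def)
    qed
  qed
  finally show "outward_normal B -` K \<inter> space borel \<in> sets borel" .
qed auto

section \<open>Cylindrical waves\<close>

text \<open>
  The entire function \<open>E\<^sub>m\<close> with \<open>J\<^sub>m(x) = (x / 2)\<^sup>m E\<^sub>m(x\<^sup>2 / 4)\<close>. Splitting off the monomial turns the
  cylindrical wave into a polynomial in \<open>x\<close> times a smooth function of \<open>\<bar>x\<bar>\<^sup>2\<close>, which shows that it is smooth
  also at the origin, where polar coordinates are singular.
\<close>
definition bessel_aux :: "nat \<Rightarrow> real \<Rightarrow> real" where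
  "bessel_aux m t = (\<Sum>k. (-1) ^ k / (fact k * fact (m + k)) * t ^ k)"

lemma bessel_aux_term_le:
  "\<bar>(-1) ^ k / (fact k * fact (m + k)) * t ^ k\<bar> \<le> inverse (fact k) * \<bar>t\<bar> ^ k / (fact m :: real)"
proof -
  have "(fact m :: real) \<le> fact (m + k)" by (rule fact_mono) simp
  then have "inverse (fact k * fact (m + k) :: real) * \<bar>t\<bar> ^ k \<le> inverse (fact k * fact m) * \<bar>t\<bar> ^ k"
    by (intro mult_right_mono le_imp_inverse_le mult_left_mono) auto
  then show ?thesis by (simp add: abs_mult power_abs divide_simps)
qed

lemma summable_bessel_aux:
  "summable (\<lambda>k. \<bar>(-1) ^ k / (fact k * fact (m + k)) * t ^ k :: real\<bar>)"
proof (rule summable_comparison_test')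
  show "summable (\<lambda>k. inverse (fact k) * \<bar>t\<bar> ^ k / (fact m :: real))"
    by (rule summable_divide[OF summable_exp])
qed (use bessel_aux_term_le in auto)

lemma abs_bessel_aux_le: "\<bar>bessel_aux m t\<bar> \<le> exp \<bar>t\<bar> / fact m"
proof -
  have "\<bar>bessel_aux m t\<bar> \<le> (\<Sum>k. \<bar>(-1) ^ k / (fact k * fact (m + k)) * t ^ k\<bar>)"
    unfolding bessel_aux_def by (rule summable_rabs[OF summable_bessel_aux])
  also have "\<dots> \<le> (\<Sum>k. inverse (fact k) * \<bar>t\<bar> ^ k / fact m)"
    by (rule suminf_le[OF bessel_aux_term_le summable_bessel_aux summable_divide[OF summable_exp]])
  also have "\<dots> = exp \<bar>t\<bar> / fact m"
    unfolding exp_def real_scaleR_def by (rule suminf_divide[OF summable_exp])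
  finally show ?thesis .
qed

lemma bessel_aux_deriv: "(bessel_aux m has_real_derivative - bessel_aux (Suc m) t) (at t)"
proof -
  define c :: "nat \<Rightarrow> nat \<Rightarrow> real" where "c m k = (-1) ^ k / (fact k * fact (m + k))" for m k
  have c: "summable (\<lambda>k. c m k * y ^ k)" for m y
    unfolding c_def by (rule summable_rabs_cancel[OF summable_bessel_aux])
  have diffs: "diffs (c m) k = - c (Suc m) k" for k
  proof -
    have "real (Suc k) \<noteq> 0" by simp
    then show ?thesis unfolding diffs_def c_def by (simp add: field_simps del: of_nat_Suc)
  qed
  have "((\<lambda>t. \<Sum>k. c m k * t ^ k) has_real_derivative (\<Sum>k. diffs (c m) k * t ^ k)) (at t)"
    by (rule termdiffs_strong_converges_everywhere[OF c])
  moreover have "(\<Sum>k. diffs (c m) k * t ^ k) = - (\<Sum>k. c (Suc m) k * t ^ k)"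
    unfolding diffs using suminf_minus[OF c, of "Suc m" t] by simp
  ultimately show ?thesis by (simp add: bessel_aux_def[abs_def] c_def)
qed

lemma continuous_on_bessel_aux [continuous_intros]:
  "continuous_on S f \<Longrightarrow> continuous_on S (\<lambda>x. bessel_aux m (f x))"
  by (rule continuous_on_compose2[of UNIV "bessel_aux m"])
     (auto intro!: DERIV_continuous_on bessel_aux_deriv)

lemma power_int_twice_add: "y powi (2 * int k + int m) = y ^ m * (y\<^sup>2) ^ k" for y :: real
  using power_int_of_nat[of y "2 * k + m"] by (simp add: power_add power_mult power2_eq_square power_mult_distrib)

lemma Bessel_J_of_nat: "Bessel_J (int m) x = (x / 2) ^ m * bessel_aux m ((x / 2)\<^sup>2)"
proof -
  have "(-1) ^ k * rGamma (of_int (int m) + of_nat k + 1) / fact k * (x / 2) powi (2 * int k + int m)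
     = (x / 2) ^ m * ((-1) ^ k / (fact k * fact (m + k)) * ((x / 2)\<^sup>2) ^ k)" for k
  proof -
    have "rGamma (of_int (int m) + of_nat k + 1 :: real) = rGamma (of_int (int (m + k) + 1))" by simp
    also have "\<dots> = inverse (fact (m + k))" unfolding rGamma_of_int by (simp add: nat_int_add)
    finally have "rGamma (of_int (int m) + of_nat k + 1 :: real) = inverse (fact (m + k))" .
    moreover have "(x / 2) powi (2 * int k + int m) = (x / 2) ^ m * ((x / 2)\<^sup>2) ^ k"
      by (rule power_int_twice_add)
    moreover have "s * inverse B / A * (X * Y) = X * (s / (A * B) * Y)" for s A B X Y :: real
      by (simp add: divide_inverse)
    ultimately show ?thesis by (simp only:)
  qed
  then show ?thesis
    unfolding Bessel_J_def bessel_aux_def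
    using suminf_mult[OF summable_rabs_cancel[OF summable_bessel_aux]] by simp
qed

text \<open>
  The first \<open>m\<close> terms of the series of order \<open>- m\<close> vanish, because the reciprocal Gamma function is zero at
  the nonpositive integers; the remaining terms are the series of order \<open>m\<close> up to sign.
\<close>
lemma Bessel_J_minus: "Bessel_J (- int m) x = (-1) ^ m * Bessel_J (int m) x"
proof -
  define f where "f k = (-1) ^ k * rGamma (of_int (- int m) + of_nat k + 1) / fact k
    * (x / 2) powi (2 * int k + - int m)" for k :: nat
  let ?g = "\<lambda>k. (-1) ^ k / (fact k * fact (m + k)) * ((x / 2)\<^sup>2) ^ k"
  have f0: "f k = 0" if "k < m" for k
  proof -
    have "rGamma (of_int (- int m) + of_nat k + 1 :: real) = rGamma (of_int (int k - int m + 1))"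
      by simp
    also have "\<dots> = 0" unfolding rGamma_of_int using that by simp
    finally show ?thesis by (simp add: f_def)
  qed
  have f1: "f (k + m) = (-1) ^ m * (x / 2) ^ m * ?g k" for k
  proof -
    have "rGamma (of_int (- int m) + of_nat (k + m) + 1 :: real) = rGamma (of_int (int k + 1))" by simp
    also have "\<dots> = inverse (fact k)" unfolding rGamma_of_int by simp
    finally have "rGamma (of_int (- int m) + of_nat (k + m) + 1 :: real) = inverse (fact k)" .
    moreover have "2 * int (k + m) + - int m = 2 * int k + int m" by simp
    ultimately have "f (k + m) = (-1) ^ (k + m) * inverse (fact k) / fact (k + m)
        * ((x / 2) ^ m * ((x / 2)\<^sup>2) ^ k)"
      unfolding f_def by (simp only: power_int_twice_add)
    moreover have "(t * s) * inverse A / B * (X * Y) = t * X * (s / (A * B) * Y)" for s t A B X Y :: real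
      by (simp add: divide_inverse)
    ultimately show ?thesis by (simp only: add.commute[of k m] power_add)
  qed
  have g: "?g sums bessel_aux m ((x / 2)\<^sup>2)"
    unfolding bessel_aux_def by (intro summable_sums summable_rabs_cancel[OF summable_bessel_aux])
  have "(\<lambda>k. f (k + m)) sums ((-1) ^ m * (x / 2) ^ m * bessel_aux m ((x / 2)\<^sup>2))"
    unfolding f1 by (intro sums_mult g)
  then have "f sums ((-1) ^ m * (x / 2) ^ m * bessel_aux m ((x / 2)\<^sup>2))"
    using sums_iff_shift[of f m] f0 by simp
  moreover have "Bessel_J (- int m) x = suminf f"
    unfolding Bessel_J_def f_def ..
  ultimately show ?thesis
    unfolding Bessel_J_of_nat by (simp add: sums_iff)
qed

lemma cyl_wave_of_nat:
  "cyl_wave \<omega> (int m) x =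
     (of_real (\<omega> / 2) * x) ^ m * of_real (bessel_aux m ((\<omega> / 2)\<^sup>2 * (x \<bullet> x)))"
proof -
  have "(of_real (norm x) * cis (Arg x)) ^ m = x ^ m"
    using rcis_cmod_Arg[of x] by (simp only: rcis_def)
  then have cis: "of_real (norm x) ^ m * cis (of_int (int m) * Arg x) = x ^ m"
    by (simp only: power_mult_distrib Complex.DeMoivre of_int_of_nat_eq)
  have half: "\<omega> * norm x / 2 = \<omega> / 2 * norm x" by simp
  have sq: "(\<omega> / 2 * norm x)\<^sup>2 = (\<omega> / 2)\<^sup>2 * (x \<bullet> x)"
    by (simp only: power_mult_distrib dot_square_norm)
  have "cyl_wave \<omega> (int m) x = of_real (\<omega> / 2) ^ m
      * (of_real (norm x) ^ m * cis (of_int (int m) * Arg x))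
      * of_real (bessel_aux m ((\<omega> / 2)\<^sup>2 * (x \<bullet> x)))"
    unfolding cyl_wave_def Bessel_J_of_nat half sq
    unfolding power_mult_distrib of_real_mult of_real_power
    by (simp only: ac_simps)
  then show ?thesis
    by (simp only: cis power_mult_distrib)
qed

lemma cyl_wave_minus: "cyl_wave \<omega> (- int m) x = (-1) ^ m * cnj (cyl_wave \<omega> (int m) x)"
  unfolding cyl_wave_def Bessel_J_minus by (simp add: cis_cnj)

definition cyl_wave_gradient :: "real \<Rightarrow> nat \<Rightarrow> complex \<Rightarrow> complex \<Rightarrow> complex" where
  "cyl_wave_gradient \<omega> m x h =
     of_nat m * (of_real (\<omega> / 2) * x) ^ (m - 1) * (of_real (\<omega> / 2) * h)
       * of_real (bessel_aux m ((\<omega> / 2)\<^sup>2 * (x \<bullet> x)))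
     - (of_real (\<omega> / 2) * x) ^ m
       * of_real (bessel_aux (Suc m) ((\<omega> / 2)\<^sup>2 * (x \<bullet> x)) * ((\<omega> / 2)\<^sup>2 * (2 * (x \<bullet> h))))"

lemma cyl_wave_of_nat_has_derivative:
  "(cyl_wave \<omega> (int m) has_derivative cyl_wave_gradient \<omega> m x) (at x)"
proof -
  have q: "((\<lambda>x. (\<omega> / 2)\<^sup>2 * (x \<bullet> x)) has_derivative (\<lambda>h. (\<omega> / 2)\<^sup>2 * (2 * (x \<bullet> h)))) (at x)"
    for x :: complex
    by (auto intro!: derivative_eq_intros simp: inner_commute algebra_simps)
  have "((\<lambda>x. bessel_aux m ((\<omega> / 2)\<^sup>2 * (x \<bullet> x))) has_derivative
      (\<lambda>h. - bessel_aux (Suc m) ((\<omega> / 2)\<^sup>2 * (x \<bullet> x)) * ((\<omega> / 2)\<^sup>2 * (2 * (x \<bullet> h))))) (at x)"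
    using has_derivative_compose[OF q has_field_derivative_imp_has_derivative[OF bessel_aux_deriv]]
    by simp
  then have "((\<lambda>x. complex_of_real (bessel_aux m ((\<omega> / 2)\<^sup>2 * (x \<bullet> x)))) has_derivative
      (\<lambda>h. of_real (- bessel_aux (Suc m) ((\<omega> / 2)\<^sup>2 * (x \<bullet> x)) * ((\<omega> / 2)\<^sup>2 * (2 * (x \<bullet> h)))))) (at x)"
    by (rule has_derivative_of_real)
  moreover have "((\<lambda>x. (complex_of_real (\<omega> / 2) * x) ^ m) has_derivative
      (\<lambda>h. of_nat m * (of_real (\<omega> / 2) * x) ^ (m - 1) * (of_real (\<omega> / 2) * h))) (at x)"
    by (auto intro!: derivative_eq_intros simp: algebra_simps)
  ultimately show ?thesis
    unfolding cyl_wave_of_nat[abs_def] cyl_wave_gradient_def[abs_def]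
    by (intro has_derivative_eq_rhs[OF has_derivative_mult]) auto
qed

lemma cyl_wave_minus_has_derivative:
  "(cyl_wave \<omega> (- int m) has_derivative (\<lambda>h. (-1) ^ m * cnj (cyl_wave_gradient \<omega> m x h))) (at x)"
  unfolding cyl_wave_minus[abs_def]
  by (intro has_derivative_mult_right has_derivative_cnj cyl_wave_of_nat_has_derivative)

lemma continuous_on_cyl_wave_gradient: "continuous_on UNIV (\<lambda>x. cyl_wave_gradient \<omega> m x h)"
  unfolding cyl_wave_gradient_def by (intro continuous_intros)

lemma C1I:
  assumes "\<And>x. (F has_derivative D x) (at x)" "\<And>h. continuous_on UNIV (\<lambda>x. D x h)"
  shows "C1 F"
proof -
  have "frechet_derivative F (at x) = D x" for x
    using frechet_derivative_at[OF assms(1)[of x]] by simp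
  then show ?thesis
    using assms by (auto simp: C1_def intro: differentiableI)
qed

lemma C1_cyl_wave: "C1 (cyl_wave \<omega> n)"
proof (cases n rule: int_cases2)
  case (nonneg m)
  show ?thesis
    unfolding nonneg by (rule C1I[OF cyl_wave_of_nat_has_derivative continuous_on_cyl_wave_gradient])
next
  case (nonpos m)
  have "continuous_on UNIV (\<lambda>x. (-1) ^ m * cnj (cyl_wave_gradient \<omega> m x h))" for h
    by (rule continuous_on_mult_left[OF continuous_on_cnj[OF continuous_on_cyl_wave_gradient]])
  then show ?thesis
    unfolding nonpos by (rule C1I[OF cyl_wave_minus_has_derivative])
qed

text \<open>
  The factorial in the denominator is what makes all series of the theorem converge absolutely. The
  base \<open>2 * a\<close> instead of \<open>a\<close> leaves room for the factor \<open>m\<close> that appears in the same bound for the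
  derivative.
\<close>
lemma norm_cyl_wave_le:
  assumes "0 \<le> \<omega>" "1 \<le> a" "\<omega> / 2 * norm x \<le> a"
  shows "norm (cyl_wave \<omega> n x) \<le> exp (a\<^sup>2) * (2 * a) ^ nat \<bar>n\<bar> / fact (nat \<bar>n\<bar>)"
proof -
  have nat: "norm (cyl_wave \<omega> (int m) x) \<le> exp (a\<^sup>2) * (2 * a) ^ m / fact m" for m
  proof -
    have le: "(\<omega> / 2)\<^sup>2 * (x \<bullet> x) \<le> a\<^sup>2"
    proof -
      have "(\<omega> / 2)\<^sup>2 * (x \<bullet> x) = (\<omega> / 2 * norm x)\<^sup>2"
        by (simp only: power_mult_distrib dot_square_norm)
      also have "\<dots> \<le> a\<^sup>2" using assms(1) by (intro power_mono assms(3)) auto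
      finally show ?thesis .
    qed
    have "norm (cyl_wave \<omega> (int m) x) = (\<omega> / 2 * norm x) ^ m * \<bar>bessel_aux m ((\<omega> / 2)\<^sup>2 * (x \<bullet> x))\<bar>"
      using assms(1) unfolding cyl_wave_of_nat by (simp add: norm_mult norm_power norm_divide)
    also have "\<dots> \<le> a ^ m * (exp (a\<^sup>2) / fact m)"
    proof (intro mult_mono power_mono assms)
      have "\<bar>bessel_aux m ((\<omega> / 2)\<^sup>2 * (x \<bullet> x))\<bar> \<le> exp \<bar>(\<omega> / 2)\<^sup>2 * (x \<bullet> x)\<bar> / fact m"
        by (rule abs_bessel_aux_le)
      also have "\<dots> \<le> exp (a\<^sup>2) / fact m" using le by (intro divide_right_mono) auto
      finally show "\<bar>bessel_aux m ((\<omega> / 2)\<^sup>2 * (x \<bullet> x))\<bar> \<le> exp (a\<^sup>2) / fact m" .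
    qed (use assms in auto)
    also have "\<dots> \<le> (2 * a) ^ m * (exp (a\<^sup>2) / fact m)"
      using assms(2) by (intro mult_right_mono power_mono) auto
    finally show ?thesis by (simp add: mult.commute)
  qed
  show ?thesis
    by (cases n rule: int_cases2) (use nat in \<open>auto simp: cyl_wave_minus norm_mult norm_power\<close>)
qed

lemma norm_cyl_wave_derivative_le:
  assumes "0 \<le> \<omega>" "1 \<le> a" "\<omega> / 2 * norm x \<le> a" "norm h \<le> 1"
  shows "norm (frechet_derivative (cyl_wave \<omega> n) (at x) h)
     \<le> (\<omega> / 2 + \<omega> * a) * exp (a\<^sup>2) * (2 * a) ^ nat \<bar>n\<bar> / fact (nat \<bar>n\<bar>)"
proof -
  have nat: "norm (cyl_wave_gradient \<omega> m x h) \<le> (\<omega> / 2 + \<omega> * a) * exp (a\<^sup>2) * (2 * a) ^ m / fact m" for m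
  proof -
    let ?q = "(\<omega> / 2)\<^sup>2 * (x \<bullet> x)"
    have le: "?q \<le> a\<^sup>2"
    proof -
      have "(\<omega> / 2)\<^sup>2 * (x \<bullet> x) = (\<omega> / 2 * norm x)\<^sup>2"
        by (simp only: power_mult_distrib dot_square_norm)
      also have "\<dots> \<le> a\<^sup>2" using assms(1) by (intro power_mono assms(3)) auto
      finally show ?thesis .
    qed
    have E: "\<bar>bessel_aux k ?q\<bar> \<le> exp (a\<^sup>2) / fact m" if "m \<le> k" for k
    proof -
      have "\<bar>bessel_aux k ?q\<bar> \<le> exp \<bar>?q\<bar> / fact k" by (rule abs_bessel_aux_le)
      also have "\<dots> \<le> exp (a\<^sup>2) / fact m"
        using le that by (intro frac_le fact_mono) auto
      finally show ?thesis .
    qed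
    have p: "(\<omega> / 2 * norm x) ^ k \<le> a ^ k" for k using assms by (intro power_mono) auto
    have "norm (cyl_wave_gradient \<omega> m x h) \<le>
        real m * (\<omega> / 2 * norm x) ^ (m - 1) * (\<omega> / 2 * norm h) * \<bar>bessel_aux m ?q\<bar>
      + (\<omega> / 2 * norm x) ^ m * (\<bar>bessel_aux (Suc m) ?q\<bar> * ((\<omega> / 2)\<^sup>2 * (2 * \<bar>x \<bullet> h\<bar>)))"
      unfolding cyl_wave_gradient_def
      by (rule order_trans[OF norm_triangle_ineq4])
         (use assms(1) in \<open>simp add: norm_mult norm_power norm_divide abs_mult\<close>)
    also have "real m * (\<omega> / 2 * norm x) ^ (m - 1) * (\<omega> / 2 * norm h) * \<bar>bessel_aux m ?q\<bar>
        \<le> 2 ^ m * a ^ m * (\<omega> / 2 * 1) * (exp (a\<^sup>2) / fact m)"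
    proof (intro mult_mono E)
      show "real m \<le> 2 ^ m" using of_nat_less_two_power[of m, where 'a = real] by simp
      have "(\<omega> / 2 * norm x) ^ (m - 1) \<le> a ^ (m - 1)" by (rule p)
      also have "\<dots> \<le> a ^ m" using assms(2) by (intro power_increasing) auto
      finally show "(\<omega> / 2 * norm x) ^ (m - 1) \<le> a ^ m" .
    qed (use assms in auto)
    also have "(\<omega> / 2 * norm x) ^ m * (\<bar>bessel_aux (Suc m) ?q\<bar> * ((\<omega> / 2)\<^sup>2 * (2 * \<bar>x \<bullet> h\<bar>)))
        \<le> (2 ^ m * a ^ m) * (exp (a\<^sup>2) / fact m * (\<omega> * a))"
    proof (rule mult_mono[OF _ mult_mono[OF E]])
      have "(\<omega> / 2 * norm x) ^ m \<le> a ^ m" by (rule p)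
      also have "\<dots> \<le> 2 ^ m * a ^ m" using assms(2) by simp
      finally show "(\<omega> / 2 * norm x) ^ m \<le> 2 ^ m * a ^ m" .
      have "\<bar>x \<bullet> h\<bar> \<le> norm x * norm h" by (rule Cauchy_Schwarz_ineq2)
      also have "\<dots> \<le> norm x * 1" using assms(4) by (intro mult_left_mono) auto
      finally have "\<omega> * (\<omega> / 2 * \<bar>x \<bullet> h\<bar>) \<le> \<omega> * (\<omega> / 2 * norm x)"
        using assms(1) by (intro mult_left_mono) auto
      also have "\<dots> \<le> \<omega> * a" using assms by (intro mult_left_mono) auto
      finally show "(\<omega> / 2)\<^sup>2 * (2 * \<bar>x \<bullet> h\<bar>) \<le> \<omega> * a" by (simp add: power2_eq_square)
    qed (use assms in auto)
    finally show ?thesis by (simp add: power_mult_distrib field_simps)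
  qed
  show ?thesis
  proof (cases n rule: int_cases2)
    case (nonneg m)
    then show ?thesis
      using nat[of m] frechet_derivative_at[OF cyl_wave_of_nat_has_derivative, symmetric, of \<omega> m x] by simp
  next
    case (nonpos m)
    then show ?thesis
      using nat[of m] frechet_derivative_at[OF cyl_wave_minus_has_derivative, symmetric, of \<omega> m x]
      by (simp add: norm_mult norm_power)
  qed
qed

lemma has_sum_exp:
  fixes a :: "'a :: {real_normed_field, banach}"
  shows "((\<lambda>k. a ^ k / fact k) has_sum exp a) UNIV"
proof (rule norm_summable_imp_has_sum)
  have eq: "a ^ k / fact k = a ^ k /\<^sub>R fact k" for k
    by (simp add: scaleR_conv_of_real divide_inverse)
  show "(\<lambda>k. a ^ k / fact k) sums exp a"
    unfolding eq by (rule exp_converges)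
  show "summable (\<lambda>k. norm (a ^ k / fact k))"
    unfolding eq by (rule summable_norm_exp)
qed

text \<open>
  The generating function of the Bessel functions: with \<open>a = (z / 2) e\<^sup>i\<^sup>\<alpha>\<close> and
  \<open>b = - (z / 2) e\<^sup>-\<^sup>i\<^sup>\<alpha>\<close> one has \<open>a + b = i z sin \<alpha>\<close>, and grouping the absolutely
  convergent double series of \<open>exp a * exp b\<close> by the difference \<open>n = j - k\<close> of the two exponents gives
  the Bessel function of order \<open>n\<close>, since \<open>a b = - (z / 2)\<^sup>2\<close>.
\<close>
lemma Jacobi_Anger:
  "((\<lambda>n. of_real (Bessel_J n z) * cis (of_int n * \<alpha>)) has_sum cis (z * sin \<alpha>)) UNIV"
proof -
  define r where "r = z / 2"
  define a where "a = of_real r * cis \<alpha>"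
  define b where "b = - 1 * (of_real r * cis (- \<alpha>))"
  define T where "T = (\<lambda>(j, k). a ^ j / fact j * (b ^ k / fact k))"
  have ab: "a * b = - of_real (r\<^sup>2)"
    by (simp add: a_def b_def power2_eq_square cis_mult)
  have "exp a * exp b = exp (a + b)" by (simp add: exp_add)
  also have "a + b = \<i> * of_real (z * sin \<alpha>)"
    by (simp add: a_def b_def r_def complex_eq_iff)
  finally have expab: "exp a * exp b = cis (z * sin \<alpha>)" by (simp add: cis_conv_exp)
  have norms: "((\<lambda>j. norm (c ^ j / fact j)) has_sum exp (norm c)) UNIV" for c :: complex
    using has_sum_exp[of "norm c"] by (simp add: norm_divide norm_power)
  have "(\<lambda>p. norm (T p)) summable_on UNIV \<times> UNIV"
  proof (rule summable_on_SigmaI)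
    show "((\<lambda>k. norm (T (j, k))) has_sum norm (a ^ j / fact j) * exp (norm b)) UNIV" for j
      using has_sum_cmult_right[OF norms[of b], of "norm (a ^ j / fact j)"]
      by (simp only: T_def norm_mult prod.case)
    show "(\<lambda>j. norm (a ^ j / fact j) * exp (norm b)) summable_on UNIV"
      by (intro summable_on_cmult_left has_sum_imp_summable[OF norms])
  qed simp
  then have "T summable_on UNIV \<times> UNIV"
    by (rule abs_summable_summable)
  then have T: "(T has_sum exp a * exp b) (UNIV \<times> UNIV)"
    by (rule has_sum_SigmaI[where g = "\<lambda>j. a ^ j / fact j * exp b", rotated 2])
       (simp_all only: T_def prod.case has_sum_cmult_right[OF has_sum_exp] has_sum_cmult_left[OF has_sum_exp])
  define F where "F n = {(j, k). int j - int k = n}" for n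
  have "bij_betw snd (Sigma UNIV F) (UNIV \<times> UNIV)"
    by (rule bij_betwI[where g = "\<lambda>(j, k). (int j - int k, (j, k))"]) (auto simp: F_def)
  then have S: "((\<lambda>p. T (snd p)) has_sum exp a * exp b) (Sigma UNIV F)"
    using T has_sum_reindex_bij_betw by blast
  have aux: "((\<lambda>k. (a * b) ^ k / (fact k * fact (m + k))) has_sum of_real (bessel_aux m (r\<^sup>2))) UNIV" for m
  proof -
    have "((\<lambda>k. (-1) ^ k / (fact k * fact (m + k)) * (r\<^sup>2) ^ k) has_sum bessel_aux m (r\<^sup>2)) UNIV"
      using summable_bessel_aux[of m "r\<^sup>2"] unfolding bessel_aux_def
      by (intro norm_summable_imp_has_sum summable_sums summable_rabs_cancel[OF summable_bessel_aux]) auto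
    then have "((\<lambda>k. complex_of_real ((-1) ^ k / (fact k * fact (m + k)) * (r\<^sup>2) ^ k))
        has_sum of_real (bessel_aux m (r\<^sup>2))) UNIV"
      by (rule has_sum_of_real)
    moreover have "complex_of_real ((-1) ^ k / (fact k * fact (m + k)) * (r\<^sup>2) ^ k)
        = (a * b) ^ k / (fact k * fact (m + k))" for k
      unfolding ab power_minus[of "of_real _"] by simp
    ultimately show ?thesis by (simp only:)
  qed
  have T1: "T (m + k, k) = a ^ m * ((a * b) ^ k / (fact k * fact (m + k)))" for m k
    unfolding T_def prod.case power_add power_mult_distrib
    by (simp only: divide_inverse inverse_mult_distrib ac_simps)
  have T2: "T (k, m + k) = b ^ m * ((a * b) ^ k / (fact k * fact (m + k)))" for m k
    unfolding T_def prod.case power_add power_mult_distrib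
    by (simp only: divide_inverse inverse_mult_distrib ac_simps)
  have fibre: "(T has_sum of_real (Bessel_J n z) * cis (of_int n * \<alpha>)) (F n)" for n
  proof (cases n rule: int_cases2)
    case (nonneg m)
    have "((\<lambda>k. a ^ m * ((a * b) ^ k / (fact k * fact (m + k)))) has_sum
        a ^ m * of_real (bessel_aux m (r\<^sup>2))) UNIV"
      by (intro has_sum_cmult_right aux)
    also have "?this \<longleftrightarrow> (T has_sum a ^ m * of_real (bessel_aux m (r\<^sup>2))) (F n)"
      by (rule has_sum_reindex_bij_witness[where j = "\<lambda>k. (m + k, k)" and i = snd])
         (use nonneg in \<open>auto simp: F_def T1\<close>)
    also have "a ^ m = of_real r ^ m * cis (of_nat m * \<alpha>)"
      unfolding a_def by (simp only: power_mult_distrib Complex.DeMoivre)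
    finally show ?thesis
      unfolding nonneg Bessel_J_of_nat r_def[symmetric]
      by (simp only: of_real_mult of_real_power of_int_of_nat_eq ac_simps)
  next
    case (nonpos m)
    have "((\<lambda>k. b ^ m * ((a * b) ^ k / (fact k * fact (m + k)))) has_sum
        b ^ m * of_real (bessel_aux m (r\<^sup>2))) UNIV"
      by (intro has_sum_cmult_right aux)
    also have "?this \<longleftrightarrow> (T has_sum b ^ m * of_real (bessel_aux m (r\<^sup>2))) (F n)"
      by (rule has_sum_reindex_bij_witness[where j = "\<lambda>k. (k, m + k)" and i = fst])
         (use nonpos in \<open>auto simp: F_def T2\<close>)
    also have "b ^ m = of_real ((- 1) ^ m) * of_real r ^ m * cis (of_nat m * - \<alpha>)"
      unfolding b_def power_mult_distrib Complex.DeMoivre by (simp only: of_real_power of_real_minus of_real_1 ac_simps)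
    also have "of_nat m * - \<alpha> = of_int (- int m) * \<alpha>" by simp
    finally show ?thesis
      unfolding nonpos Bessel_J_minus Bessel_J_of_nat r_def[symmetric]
      by (simp only: of_real_mult of_real_power ac_simps)
  qed
  have "((\<lambda>n. of_real (Bessel_J n z) * cis (of_int n * \<alpha>)) has_sum exp a * exp b) UNIV"
    by (rule has_sum_SigmaD[OF S]) (use fibre in simp)
  then show ?thesis using expab by simp
qed

text \<open>
  The generating function at angle \<open>\<theta> - \<pi> / 2 - arg y\<close>, whose sine is \<open>- cos (\<theta> - arg y)\<close>.
\<close>
lemma plane_wave_expansion:
  "((\<lambda>n. cis (of_int n * (\<theta> - pi / 2)) * cnj (cyl_wave \<omega> n y)) has_sum
     cis (- \<omega> * norm y * cos (\<theta> - Arg y))) UNIV"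
proof -
  have "cis (of_int n * (\<theta> - pi / 2)) * cnj (cyl_wave \<omega> n y)
      = of_real (Bessel_J n (\<omega> * norm y)) * cis (of_int n * (\<theta> - pi / 2 - Arg y))" for n
    by (simp add: cyl_wave_def cis_cnj cis_mult algebra_simps)
  moreover have "sin (\<theta> - pi / 2 - Arg y) = - cos (\<theta> - Arg y)"
    using sin_diff[of "\<theta> - Arg y" "pi / 2"] by (simp add: algebra_simps)
  ultimately show ?thesis
    using Jacobi_Anger[of "\<omega> * norm y" "\<theta> - pi / 2 - Arg y"] by simp
qed

lemma summable_on_power_fact:
  fixes b :: real
  shows "(\<lambda>n::int. b ^ nat \<bar>n\<bar> / fact (nat \<bar>n\<bar>)) summable_on UNIV"
proof -
  have nat: "(\<lambda>m::nat. b ^ m / fact m) summable_on UNIV"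
    using has_sum_exp by (rule has_sum_imp_summable)
  have "(\<lambda>n::int. b ^ nat \<bar>n\<bar> / fact (nat \<bar>n\<bar>)) summable_on range int"
    using nat by (subst summable_on_reindex) (auto simp: o_def)
  moreover have "(\<lambda>n::int. b ^ nat \<bar>n\<bar> / fact (nat \<bar>n\<bar>)) summable_on range (\<lambda>m. - int m)"
    using nat by (subst summable_on_reindex) (auto simp: o_def inj_def)
  ultimately have "(\<lambda>n::int. b ^ nat \<bar>n\<bar> / fact (nat \<bar>n\<bar>)) summable_on range int \<union> range (\<lambda>m. - int m)"
    by (rule summable_on_union)
  also have "range int \<union> range (\<lambda>m. - int m) = UNIV"
    by (auto intro: int_cases2)
  finally show ?thesis .
qed

lemma bounded_in_L2:
  assumes "finite_measure M" "f \<in> borel_measurable M" "\<And>x. x \<in> space M \<Longrightarrow> norm (f x) \<le> c" "0 \<le> c"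
  shows "f \<in> L2 M" and "L2_norm M f \<le> c * sqrt (measure M (space M))"
proof -
  interpret finite_measure M by fact
  have le: "(norm (f x))\<^sup>2 \<le> c\<^sup>2" if "x \<in> space M" for x
    using assms(3)[OF that] by (intro power_mono) auto
  have int: "integrable M (\<lambda>x. (norm (f x))\<^sup>2)"
    using le assms(2) by (intro integrable_const_bound[where B = "c\<^sup>2"]) auto
  then show "f \<in> L2 M" using assms(2) by (simp add: L2_def)
  have "(\<integral>x. (norm (f x))\<^sup>2 \<partial>M) \<le> (\<integral>x. c\<^sup>2 \<partial>M)"
    using le int by (intro integral_mono) auto
  then have "(\<integral>x. (norm (f x))\<^sup>2 \<partial>M) \<le> c\<^sup>2 * measure M (space M)"
    by (simp add: mult.commute)
  then have "L2_norm M f \<le> sqrt (c\<^sup>2 * measure M (space M))"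
    unfolding L2_norm_def by (rule real_sqrt_le_mono)
  then show "L2_norm M f \<le> c * sqrt (measure M (space M))"
    using assms(4) by (simp add: real_sqrt_mult)
qed

section \<open>Densities of the scattering problem\<close>

text \<open>
  The bound comes from the pointwise inequality \<open>t \<le> (s + t\<^sup>2 / s) / 2\<close>, integrated with \<open>s\<close> the bound on the
  \<open>L\<^sup>2\<close> norm; it is linear in \<open>s\<close>, which preserves the decay of a family of functions.
\<close>
lemma L2_imp_L1:
  assumes "finite_measure M" "f \<in> L2 M" "L2_norm M f \<le> s" "0 < s"
  shows "integrable M f" and "(\<integral>x. norm (f x) \<partial>M) \<le> s * ((measure M (space M) + 1) / 2)"
proof -
  interpret finite_measure M by fact
  have f: "f \<in> borel_measurable M" "integrable M (\<lambda>x. (norm (f x))\<^sup>2)"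
    using assms(2) by (auto simp: L2_def)
  have pw: "norm (f x) \<le> (s + (norm (f x))\<^sup>2 / s) / 2" for x
  proof -
    have "0 \<le> (norm (f x) - s)\<^sup>2" by simp
    then show ?thesis using assms(4) by (simp add: field_simps power2_eq_square)
  qed
  have int: "integrable M (\<lambda>x. (s + (norm (f x))\<^sup>2 / s) / 2)" using f by auto
  show "integrable M f"
    by (rule Bochner_Integration.integrable_bound[OF int f(1)]) (use pw assms(4) in \<open>auto intro!: AE_I2 order_trans[OF pw]\<close>)
  then have "(\<integral>x. norm (f x) \<partial>M) \<le> (\<integral>x. (s + (norm (f x))\<^sup>2 / s) / 2 \<partial>M)"
    using int pw by (intro integral_mono) auto
  also have "\<dots> = (s * measure M (space M) + (\<integral>x. (norm (f x))\<^sup>2 \<partial>M) / s) / 2"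
    using f by (simp add: mult.commute)
  also have "(\<integral>x. (norm (f x))\<^sup>2 \<partial>M) / s \<le> s"
  proof -
    have "(\<integral>x. (norm (f x))\<^sup>2 \<partial>M) \<le> s\<^sup>2"
      using assms(3) unfolding L2_norm_def by (rule sqrt_le_D)
    then show ?thesis using assms(4) by (simp add: field_simps power2_eq_square)
  qed
  finally show "(\<integral>x. norm (f x) \<partial>M) \<le> s * ((measure M (space M) + 1) / 2)"
    by (simp add: algebra_simps)
qed

lemma L2_norm_cong_AE:
  assumes "f \<in> L2 M" "g \<in> L2 M" "AE x in M. f x = g x"
  shows "L2_norm M f = L2_norm M g"
  unfolding L2_norm_def using assms
  by (intro arg_cong[where f = sqrt] integral_cong_AE) (auto simp: L2_def)

lemma L2_norm_nonneg [simp]: "0 \<le> L2_norm M f"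
  by (simp add: L2_norm_def)

lemma borel_measurable_directional_derivative:
  assumes F: "C1 F" and v: "v \<in> borel_measurable borel"
  shows "(\<lambda>x. frechet_derivative F (at x) (v x)) \<in> borel_measurable borel"
proof -
  have DF: "(\<lambda>x. frechet_derivative F (at x) e) \<in> borel_measurable borel" for e
    using F by (intro borel_measurable_continuous_onI) (simp add: C1_def)
  have lin: "frechet_derivative F (at x) h
      = Re h *\<^sub>R frechet_derivative F (at x) 1 + Im h *\<^sub>R frechet_derivative F (at x) \<i>" for x h
  proof -
    have L: "linear (frechet_derivative F (at x))"
      using F by (intro linear_frechet_derivative) (simp add: C1_def)
    have "h = Re h *\<^sub>R 1 + Im h *\<^sub>R \<i>" by (simp add: complex_eq_iff)
    then have "frechet_derivative F (at x) h = frechet_derivative F (at x) (Re h *\<^sub>R 1 + Im h *\<^sub>R \<i>)"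
      by (rule arg_cong)
    then show ?thesis by (simp only: linear_add[OF L] linear_scale[OF L])
  qed
  have "(\<lambda>x. frechet_derivative F (at x) (v x)) = (\<lambda>x. Re (v x) *\<^sub>R frechet_derivative F (at x) 1
      + Im (v x) *\<^sub>R frechet_derivative F (at x) \<i>)" by (intro ext lin)
  also have "\<dots> \<in> borel_measurable borel"
    by (intro borel_measurable_add borel_measurable_scaleR DF measurable_compose[OF v borel_measurable_Re]
        measurable_compose[OF v borel_measurable_Im])
  finally show ?thesis .
qed

lemma C1_imp_borel_measurable: "C1 F \<Longrightarrow> F \<in> borel_measurable borel"
  unfolding C1_def
  by (intro borel_measurable_continuous_onI continuous_at_imp_continuous_on)
     (auto intro: differentiable_imp_continuous_within)

lemma C1_boundary_data:
  assumes B: "bounded B" "lipschitz_domain B" and F: "C1 F"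
    and c: "\<And>x. x \<in> frontier B \<Longrightarrow> norm (F x) \<le> c"
      "\<And>x h. x \<in> frontier B \<Longrightarrow> norm h \<le> 1 \<Longrightarrow> norm (frechet_derivative F (at x) h) \<le> c"
      "0 \<le> c"
  defines "s \<equiv> sqrt (measure (bdry B) (space (bdry B)))"
  shows "F \<in> L2 (bdry B)" "L2_norm (bdry B) F \<le> c * s"
    "normal_deriv B F \<in> L2 (bdry B)" "L2_norm (bdry B) (normal_deriv B F) \<le> c * s"
    "tangential_deriv B F \<in> L2 (bdry B)" "L2_norm (bdry B) (tangential_deriv B F) \<le> c * s"
proof -
  have "open B" using B(2) by (simp add: lipschitz_domain_def)
  note fin = finite_measure_bdry[OF B]
  note n = borel_measurable_outward_normal[OF \<open>open B\<close>]
  have "F \<in> borel_measurable (bdry B)"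
    by (intro borel_measurable_bdry C1_imp_borel_measurable F)
  from bounded_in_L2[OF fin this, of c] c show "F \<in> L2 (bdry B)" "L2_norm (bdry B) F \<le> c * s"
    by (auto simp: s_def)
  have "normal_deriv B F \<in> borel_measurable (bdry B)"
    unfolding normal_deriv_def[abs_def]
    by (intro borel_measurable_bdry borel_measurable_directional_derivative F n)
  from bounded_in_L2[OF fin this, of c] c(2,3) norm_outward_normal_le
  show "normal_deriv B F \<in> L2 (bdry B)" "L2_norm (bdry B) (normal_deriv B F) \<le> c * s"
    by (auto simp: s_def normal_deriv_def)
  have "tangential_deriv B F \<in> borel_measurable (bdry B)"
    unfolding tangential_deriv_def[abs_def]
    by (intro borel_measurable_bdry borel_measurable_directional_derivative F borel_measurable_times n) auto
  from bounded_in_L2[OF fin this, of c] c(2,3) norm_outward_normal_le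
  show "tangential_deriv B F \<in> L2 (bdry B)" "L2_norm (bdry B) (tangential_deriv B F) \<le> c * s"
    by (auto simp: s_def tangential_deriv_def norm_mult)
qed

lemma L2_conv_const: "AE x in M. F x = f x \<Longrightarrow> L2_conv M (\<lambda>_. F) f"
proof -
  assume "AE x in M. F x = f x"
  then have "(\<integral>\<^sup>+x. ennreal ((norm (F x - f x))\<^sup>2) \<partial>M) = (\<integral>\<^sup>+x. 0 \<partial>M)"
    by (intro nn_integral_cong_AE) auto
  then show ?thesis by (simp add: L2_conv_def)
qed

text \<open>
  The approximating sequence can be taken constant.
\<close>
lemma has_tangential_deriv_C1:
  assumes "C1 F" "f \<in> L2 (bdry B)" "tangential_deriv B F \<in> L2 (bdry B)" "AE x in bdry B. F x = f x"
  shows "has_tangential_deriv B f (tangential_deriv B F)"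
  unfolding has_tangential_deriv_def
  using assms by (intro conjI exI[of _ "\<lambda>_. F"] allI L2_conv_const) auto

lemma H1_bdry_norm_le:
  assumes "has_tangential_deriv B f g"
  shows "H1_bdry_norm B f \<le> L2_norm (bdry B) f + L2_norm (bdry B) g"
proof -
  have "H1_bdry_norm B f \<le> sqrt ((L2_norm (bdry B) f)\<^sup>2 + (L2_norm (bdry B) g)\<^sup>2)"
    unfolding H1_bdry_norm_def using assms by (intro cINF_lower bdd_belowI2[of _ 0]) auto
  also have "\<dots> \<le> L2_norm (bdry B) f + L2_norm (bdry B) g"
    by (rule sqrt_sum_squares_le_sum) auto
  finally show ?thesis .
qed

lemma H1_bdry_norm_nonneg: "f \<in> H1_bdry B \<Longrightarrow> 0 \<le> H1_bdry_norm B f"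
  unfolding H1_bdry_norm_def H1_bdry_def by (intro cINF_greatest) auto

text \<open>
  Existence and size of the densities come from invertibility: the boundary data of a cylindrical wave
  lie in the target space, so surjectivity provides a solution, which makes the choice in
  \<^const>\<open>scat_density\<close> meaningful, and the bounded inverse controls the solution by the data.
\<close>
lemma scat_density_L2_bound:
  assumes B: "bounded B" "lipschitz_domain B" and inv: "scat_op_invertible B \<sigma> \<mu> \<omega>"
  obtains K where "0 \<le> K" and "\<And>m c. (\<And>x. x \<in> frontier B \<Longrightarrow> norm (cyl_wave \<omega> m x) \<le> c) \<Longrightarrow>
     (\<And>x h. x \<in> frontier B \<Longrightarrow> norm h \<le> 1 \<Longrightarrow>
        norm (frechet_derivative (cyl_wave \<omega> m) (at x) h) \<le> c) \<Longrightarrow> 0 \<le> c \<Longrightarrow>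
     fst (scat_density B \<sigma> \<mu> \<omega> m) \<in> L2 (bdry B) \<and>
     L2_norm (bdry B) (fst (scat_density B \<sigma> \<mu> \<omega> m)) \<le> K * c"
proof -
  define A where "A = scat_op B \<sigma> \<mu> \<omega>"
  define X where "X = L2 (bdry B) \<times> L2 (bdry B)"
  define Y where "Y = H1_bdry B \<times> L2 (bdry B)"
  have "\<forall>p\<in>X. A p \<in> Y"
    and "\<forall>q\<in>Y. \<exists>p\<in>X. AE_eq_pair B (A p) q"
    and "\<exists>C. \<forall>p\<in>X. L2_norm (bdry B) (fst p) + L2_norm (bdry B) (snd p)
          \<le> C * (H1_bdry_norm B (fst (A p)) + L2_norm (bdry B) (snd (A p)))"
    using inv unfolding scat_op_invertible_def Let_def case_prod_beta
      A_def[symmetric] X_def[symmetric] Y_def[symmetric]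
    by - (elim conjE, assumption)+
  then obtain C where maps: "\<And>p. p \<in> X \<Longrightarrow> A p \<in> Y"
    and onto: "\<And>q. q \<in> Y \<Longrightarrow> \<exists>p\<in>X. AE_eq_pair B (A p) q"
    and C: "\<And>p. p \<in> X \<Longrightarrow> L2_norm (bdry B) (fst p) + L2_norm (bdry B) (snd p)
          \<le> C * (H1_bdry_norm B (fst (A p)) + L2_norm (bdry B) (snd (A p)))"
    by metis
  define s where "s = sqrt (measure (bdry B) (space (bdry B)))"
  have "fst (scat_density B \<sigma> \<mu> \<omega> m) \<in> L2 (bdry B) \<and>
     L2_norm (bdry B) (fst (scat_density B \<sigma> \<mu> \<omega> m)) \<le> \<bar>C\<bar> * 3 * s * c"
    if c: "\<And>x. x \<in> frontier B \<Longrightarrow> norm (cyl_wave \<omega> m x) \<le> c"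
      "\<And>x h. x \<in> frontier B \<Longrightarrow> norm h \<le> 1 \<Longrightarrow>
        norm (frechet_derivative (cyl_wave \<omega> m) (at x) h) \<le> c" "0 \<le> c" for m c
  proof -
    define F where "F = cyl_wave \<omega> m"
    have F: "C1 F" unfolding F_def by (rule C1_cyl_wave)
    note data = C1_boundary_data[OF B F c[folded F_def], folded s_def]
    have "has_tangential_deriv B F (tangential_deriv B F)"
      by (intro has_tangential_deriv_C1 F data) auto
    then have "(F, normal_deriv B F) \<in> Y"
      using data by (auto simp: Y_def H1_bdry_def)
    then obtain p0 where "p0 \<in> X" "AE_eq_pair B (A p0) (F, normal_deriv B F)"
      using onto by blast
    then have "\<exists>p. p \<in> X \<and> AE_eq_pair B (A p) (F, normal_deriv B F)" by blast
    then have "scat_density B \<sigma> \<mu> \<omega> m \<in> X \<and>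
        AE_eq_pair B (A (scat_density B \<sigma> \<mu> \<omega> m)) (F, normal_deriv B F)"
      unfolding scat_density_def A_def X_def F_def by (rule someI_ex)
    then obtain p where p: "scat_density B \<sigma> \<mu> \<omega> m = p" "p \<in> X" "A p \<in> Y"
      "AE x in bdry B. fst (A p) x = F x" "AE x in bdry B. snd (A p) x = normal_deriv B F x"
      using maps by (auto simp: AE_eq_pair_def)
    have "fst (A p) \<in> H1_bdry B" "snd (A p) \<in> L2 (bdry B)"
      using p(3) by (simp_all add: Y_def mem_Times_iff)
    moreover from this(1) have "fst (A p) \<in> L2 (bdry B)"
      unfolding H1_bdry_def has_tangential_deriv_def by blast
    ultimately have AL2: "fst (A p) \<in> H1_bdry B" "fst (A p) \<in> L2 (bdry B)" "snd (A p) \<in> L2 (bdry B)"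
      by blast+
    \<comment> \<open>The image agrees with the wave only almost everywhere, so the norms of the data have to be transferred.\<close>
    have "AE x in bdry B. F x = fst (A p) x" using p(4) by (simp add: eq_commute)
    then have "has_tangential_deriv B (fst (A p)) (tangential_deriv B F)"
      by (intro has_tangential_deriv_C1 F AL2 data)
    from H1_bdry_norm_le[OF this] have "H1_bdry_norm B (fst (A p)) \<le> c * s + c * s"
      using L2_norm_cong_AE[OF AL2(2) data(1) p(4)] data(2,6) by linarith
    moreover have "L2_norm (bdry B) (snd (A p)) \<le> c * s"
      using L2_norm_cong_AE[OF AL2(3) data(3) p(5)] data(4) by linarith
    ultimately have norm: "H1_bdry_norm B (fst (A p)) + L2_norm (bdry B) (snd (A p)) \<le> 3 * s * c"
      by (simp add: algebra_simps)
    have "L2_norm (bdry B) (fst p) \<le> L2_norm (bdry B) (fst p) + L2_norm (bdry B) (snd p)" by simp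
    also have "\<dots> \<le> C * (H1_bdry_norm B (fst (A p)) + L2_norm (bdry B) (snd (A p)))"
      by (rule C[OF p(2)])
    also have "\<dots> \<le> \<bar>C\<bar> * (H1_bdry_norm B (fst (A p)) + L2_norm (bdry B) (snd (A p)))"
      using H1_bdry_norm_nonneg[OF AL2(1)] by (intro mult_right_mono) auto
    also have "\<dots> \<le> \<bar>C\<bar> * (3 * s * c)" using norm by (intro mult_left_mono) auto
    finally show ?thesis using p(1,2) by (auto simp: X_def)
  qed
  moreover have "0 \<le> \<bar>C\<bar> * 3 * s" by (simp add: s_def)
  ultimately show ?thesis using that by blast
qed

section \<open>The far-field expansion\<close>

text \<open>
  Without polar coordinates the plane wave is visibly continuous, hence measurable.
\<close>
lemma plane_wave_eq:
  "cis (- \<omega> * norm y * cos (\<theta> - Arg y)) = cis (- \<omega> * Re (y * cis (- \<theta>)))"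
proof -
  have "y * cis (- \<theta>) = rcis (norm y) (Arg y - \<theta>)"
    using rcis_cmod_Arg[of y] by (metis add_uminus_conv_diff cis_rcis_eq mult_1_right rcis_mult)
  then have "Re (y * cis (- \<theta>)) = norm y * cos (\<theta> - Arg y)"
    using cos_minus[of "Arg y - \<theta>"] by simp
  then show ?thesis by (simp add: mult.assoc)
qed

text \<open>
  All bounds below are constants times \<open>P n = (2 a)\<^bsup>\<bar>n\<bar>\<^esup> / \<bar>n\<bar>!\<close>, which is summable over the integers:
  the waves on the boundary, then the densities through the bounded inverse, and finally the double series,
  whose term of index \<open>(m, n)\<close> is at most a constant times \<open>P m * P n\<close>. Absolute summability turns
  the iterated sum into the double sum.
\<close>
lemma scattering_expansion:
  fixes B :: "complex set" and \<sigma> \<mu> :: "complex \<Rightarrow> real" and \<omega> \<theta>\<xi> \<theta>x :: real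
  assumes \<omega>: "0 < \<omega>" and B: "bounded B" "lipschitz_domain B"
    and inv: "scat_op_invertible B \<sigma> \<mu> \<omega>"
  shows "((\<lambda>(m, n). cis (of_int m * (pi / 2 - \<theta>\<xi>)) * cis (of_int n * (\<theta>x - pi / 2))
            * scat_coeff B \<sigma> \<mu> \<omega> n m)
          has_sum far_field B \<sigma> \<mu> \<omega> \<theta>\<xi> \<theta>x) (UNIV :: (int \<times> int) set)"
proof -
  let ?M = "bdry B" and ?\<phi> = "\<lambda>m. fst (scat_density B \<sigma> \<mu> \<omega> m)"
  note fin = finite_measure_bdry[OF B]
  obtain R where R: "\<And>x. x \<in> frontier B \<Longrightarrow> norm x \<le> R"
    using compact_frontier_bounded[OF B(1)] compact_imp_bounded bounded_iff by metis
  \<comment> \<open>The maximum with 1 makes the powers of a increasing in the exponent.\<close>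
  define a where "a = max 1 (\<omega> / 2 * R)"
  define P where "P n = (2 * a) ^ nat \<bar>n\<bar> / fact (nat \<bar>n\<bar>)" for n :: int
  \<comment> \<open>The common prefactor of the bounds for the waves and for their derivatives.\<close>
  define K1 where "K1 = (1 + \<omega> / 2 + \<omega> * a) * exp (a\<^sup>2)"
  have a: "1 \<le> a" "\<And>x. x \<in> frontier B \<Longrightarrow> \<omega> / 2 * norm x \<le> a"
  proof -
    show "1 \<le> a" by (simp add: a_def)
    fix x assume "x \<in> frontier B"
    then have "\<omega> / 2 * norm x \<le> \<omega> / 2 * R" using R \<omega> by (intro mult_left_mono) auto
    then show "\<omega> / 2 * norm x \<le> a" by (simp add: a_def)
  qed
  have P: "0 < P n" for n using a(1) by (simp add: P_def)
  have sumP: "P summable_on UNIV"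
    unfolding P_def[abs_def] by (rule summable_on_power_fact)
  have "0 \<le> \<omega> * a" using \<omega> a(1) by simp
  then have "0 \<le> (\<omega> / 2 + \<omega> * a) * exp (a\<^sup>2)" using \<omega> by simp
  moreover have "K1 = exp (a\<^sup>2) + (\<omega> / 2 + \<omega> * a) * exp (a\<^sup>2)"
    by (simp add: K1_def distrib_right)
  ultimately have K1: "exp (a\<^sup>2) \<le> K1" "(\<omega> / 2 + \<omega> * a) * exp (a\<^sup>2) \<le> K1" "0 < K1"
    using exp_gt_zero[of "a\<^sup>2"] by linarith+
  have wave: "norm (cyl_wave \<omega> n x) \<le> K1 * P n" if "x \<in> frontier B" for n x
  proof -
    have "norm (cyl_wave \<omega> n x) \<le> exp (a\<^sup>2) * P n"
      using norm_cyl_wave_le[OF _ a(1) a(2)[OF that]] \<omega> by (simp add: P_def)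
    also have "\<dots> \<le> K1 * P n" using K1 P[of n] by (intro mult_right_mono) auto
    finally show ?thesis .
  qed
  have wave': "norm (frechet_derivative (cyl_wave \<omega> n) (at x) h) \<le> K1 * P n"
    if "x \<in> frontier B" "norm h \<le> 1" for n x h
  proof -
    have "norm (frechet_derivative (cyl_wave \<omega> n) (at x) h) \<le> (\<omega> / 2 + \<omega> * a) * exp (a\<^sup>2) * P n"
      using norm_cyl_wave_derivative_le[OF _ a(1) a(2)[OF that(1)] that(2)] \<omega> by (simp add: P_def)
    also have "\<dots> \<le> K1 * P n" using K1 P[of n] by (intro mult_right_mono) auto
    finally show ?thesis .
  qed
  obtain K where K: "0 \<le> K" "\<And>m. ?\<phi> m \<in> L2 ?M \<and> L2_norm ?M (?\<phi> m) \<le> K * (K1 * P m)"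
  proof (rule scat_density_L2_bound[OF B inv])
    fix K assume K: "0 \<le> K" "\<And>m c. (\<And>x. x \<in> frontier B \<Longrightarrow> norm (cyl_wave \<omega> m x) \<le> c) \<Longrightarrow>
     (\<And>x h. x \<in> frontier B \<Longrightarrow> norm h \<le> 1 \<Longrightarrow>
        norm (frechet_derivative (cyl_wave \<omega> m) (at x) h) \<le> c) \<Longrightarrow> 0 \<le> c \<Longrightarrow>
     fst (scat_density B \<sigma> \<mu> \<omega> m) \<in> L2 (bdry B) \<and>
     L2_norm (bdry B) (fst (scat_density B \<sigma> \<mu> \<omega> m)) \<le> K * c"
    show thesis
      by (rule that[OF K(1) K(2)]) (use wave wave' K1(3) P in \<open>auto simp: less_imp_le\<close>)
  qed
  define K2 where "K2 = (K * K1 + 1) * ((measure ?M (space ?M) + 1) / 2)"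
  have dens: "integrable ?M (?\<phi> m)" "(\<integral>y. norm (?\<phi> m y) \<partial>?M) \<le> K2 * P m" for m
  proof -
    \<comment> \<open>The summand 1 only makes the bound strictly positive.\<close>
    have le: "L2_norm ?M (?\<phi> m) \<le> (K * K1 + 1) * P m"
      using K(2)[of m] P[of m] by (simp add: algebra_simps)
    have pos: "0 < (K * K1 + 1) * P m" using K(1) K1(3) P by (simp add: add_nonneg_pos)
    note L1 = L2_imp_L1[OF fin conjunct1[OF K(2)] le pos]
    show "integrable ?M (?\<phi> m)" by (rule L1(1))
    have "K2 * P m = (K * K1 + 1) * P m * ((measure ?M (space ?M) + 1) / 2)"
      by (simp only: K2_def ac_simps)
    then show "(\<integral>y. norm (?\<phi> m y) \<partial>?M) \<le> K2 * P m" using L1(2) by (simp only:)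
  qed
  define f where "f n y = cis (of_int n * (\<theta>x - pi / 2)) * cnj (cyl_wave \<omega> n y)" for n y
  have fmeas: "f n \<in> borel_measurable ?M" for n
    unfolding f_def[abs_def]
    by (intro borel_measurable_bdry borel_measurable_continuous_onI continuous_intros
        continuous_at_imp_continuous_on)
       (use C1_cyl_wave[of \<omega> n] in \<open>auto simp: C1_def intro: differentiable_imp_continuous_within\<close>)
  have fle: "norm (f n y) \<le> K1 * P n" if "y \<in> space ?M" for n y
    using wave that by (simp add: f_def norm_mult)
  have coeff: "cis (of_int n * (\<theta>x - pi / 2)) * scat_coeff B \<sigma> \<mu> \<omega> n m = (\<integral>y. f n y * ?\<phi> m y \<partial>?M)" for n m
    by (simp add: scat_coeff_def f_def mult.assoc)
  define g where "g m = (\<integral>y. cis (- \<omega> * norm y * cos (\<theta>x - Arg y)) * ?\<phi> m y \<partial>?M)" for m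
  have inner: "((\<lambda>n. \<integral>y. f n y * ?\<phi> m y \<partial>?M) has_sum g m) UNIV" for m
    unfolding g_def
  proof (rule has_sum_integral_uniform[OF dens(1) fmeas])
    show "(\<lambda>y. cis (- \<omega> * norm y * cos (\<theta>x - Arg y))) \<in> borel_measurable ?M"
      unfolding plane_wave_eq
      by (intro borel_measurable_bdry borel_measurable_continuous_onI continuous_intros)
    show "((\<lambda>n. f n y) has_sum cis (- \<omega> * norm y * cos (\<theta>x - Arg y))) UNIV" for y
      unfolding f_def by (rule plane_wave_expansion)
    show "(\<lambda>n. K1 * P n) summable_on UNIV" by (intro summable_on_cmult_right sumP)
  qed (rule fle)
  define T where "T = (\<lambda>(m, n). cis (of_int m * (pi / 2 - \<theta>\<xi>)) * cis (of_int n * (\<theta>x - pi / 2))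
            * scat_coeff B \<sigma> \<mu> \<omega> n m)"
  have T: "T (m, n) = cis (of_int m * (pi / 2 - \<theta>\<xi>)) * (\<integral>y. f n y * ?\<phi> m y \<partial>?M)" for m n
    by (simp only: T_def prod.case coeff[symmetric] mult.assoc)
  have Tle: "norm (T (m, n)) \<le> (K2 * P m) * (K1 * P n)" for m n
  proof -
    have "norm (T (m, n)) = norm (\<integral>y. f n y * ?\<phi> m y \<partial>?M)" by (simp add: T norm_mult)
    also have "\<dots> \<le> (\<integral>y. norm (f n y * ?\<phi> m y) \<partial>?M)" by (rule integral_norm_bound)
    also have "\<dots> \<le> (\<integral>y. K1 * P n * norm (?\<phi> m y) \<partial>?M)"
    proof (rule integral_mono)
      show maj: "integrable ?M (\<lambda>y. K1 * P n * norm (?\<phi> m y))" using dens(1)[of m] by auto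
      show le: "norm (f n y * ?\<phi> m y) \<le> K1 * P n * norm (?\<phi> m y)" if "y \<in> space ?M" for y
        unfolding norm_mult using fle[OF that] by (intro mult_right_mono) auto
      show "integrable ?M (\<lambda>y. norm (f n y * ?\<phi> m y))"
      proof (rule Bochner_Integration.integrable_bound[OF maj])
        have "(\<lambda>y. f n y * ?\<phi> m y) \<in> borel_measurable ?M"
          by (intro borel_measurable_times fmeas borel_measurable_integrable dens(1))
        then show "(\<lambda>y. norm (f n y * ?\<phi> m y)) \<in> borel_measurable ?M"
          by (rule measurable_compose[OF _ borel_measurable_norm])
        show "AE y in ?M. norm (norm (f n y * ?\<phi> m y)) \<le> norm (K1 * P n * norm (?\<phi> m y))"
          using le by (intro AE_I2) (auto intro: order_trans[OF _ abs_ge_self])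
      qed
    qed
    also have "\<dots> = K1 * P n * (\<integral>y. norm (?\<phi> m y) \<partial>?M)" by simp
    also have "\<dots> \<le> K1 * P n * (K2 * P m)"
      using K1(3) P[of n] by (intro mult_left_mono dens(2)) auto
    finally show ?thesis by (simp only: ac_simps)
  qed
  have "(\<lambda>(m, n). (K2 * P m) * (K1 * P n)) summable_on UNIV \<times> UNIV"
  proof (rule summable_on_SigmaI)
    show "((\<lambda>n. case (m, n) of (m, n) \<Rightarrow> (K2 * P m) * (K1 * P n)) has_sum
        (K2 * P m) * (K1 * infsum P UNIV)) UNIV" for m
      using sumP by (simp only: prod.case) (intro has_sum_cmult_right has_sum_infsum)
    show "(\<lambda>m. (K2 * P m) * (K1 * infsum P UNIV)) summable_on UNIV"
      by (intro summable_on_cmult_left summable_on_cmult_right sumP)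
    show "0 \<le> (case (m, n) of (m, n) \<Rightarrow> (K2 * P m) * (K1 * P n))" for m n
      using order_trans[OF norm_ge_zero Tle[of m n]] by simp
  qed
  then have "(\<lambda>p. norm (T p)) summable_on UNIV \<times> UNIV"
    by (rule summable_on_comparison_test) (use Tle in auto)
  then have "T summable_on UNIV \<times> UNIV" by (rule abs_summable_summable)
  then have sumT: "(T has_sum infsum T (UNIV \<times> UNIV)) (UNIV \<times> UNIV)" by (rule has_sum_infsum)
  have "((\<lambda>m. cis (of_int m * (pi / 2 - \<theta>\<xi>)) * g m) has_sum infsum T (UNIV \<times> UNIV)) UNIV"
    by (rule has_sum_SigmaD[OF sumT]) (simp only: T has_sum_cmult_right[OF inner])
  then have "far_field B \<sigma> \<mu> \<omega> \<theta>\<xi> \<theta>x = infsum T (UNIV \<times> UNIV)"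
    unfolding far_field_def g_def by (rule infsumI)
  then show ?thesis using sumT unfolding T_def by simp
qed

theorem proposition5p1:
  fixes B :: "complex set" and \<sigma> \<mu> :: "complex \<Rightarrow> real"
    and \<omega> l1 l2 l3 l4 \<theta>\<xi> \<theta>x :: real
  assumes "0 < \<omega>"
    and "\<And>x. 0 < \<sigma> x" and "\<And>x. 0 < \<mu> x"
    and "(\<lambda>x. 1 / \<sigma> x) \<in> borel_measurable lebesgue" and "\<mu> \<in> borel_measurable lebesgue"
    and "0 < l1" and "\<And>x. l1 \<le> 1 / \<sigma> x" and "\<And>x. 1 / \<sigma> x \<le> l2"
    and "0 < l3" and "\<And>x. l3 \<le> \<mu> x" and "\<And>x. \<mu> x \<le> l4"
    and "bounded B" and "lipschitz_domain B" and "0 \<in> B"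
    and "compact (closure (support_on UNIV (\<lambda>x. 1 / \<sigma> x - 1)))"
    and "closure (support_on UNIV (\<lambda>x. 1 / \<sigma> x - 1)) \<subseteq> B"
    and "compact (closure (support_on UNIV (\<lambda>x. \<mu> x - 1)))"
    and "closure (support_on UNIV (\<lambda>x. \<mu> x - 1)) \<subseteq> B"
    and "\<not> neumann_eigenvalue B \<sigma> \<mu> (\<omega>\<^sup>2)" and "\<not> dirichlet_eigenvalue B (\<omega>\<^sup>2)"
    and "scat_op_invertible B \<sigma> \<mu> \<omega>"
    and "\<theta>\<xi> \<in> {0..2 * pi}" and "\<theta>x \<in> {0..2 * pi}"
  shows "((\<lambda>(m, n). cis (of_int m * (pi / 2 - \<theta>\<xi>)) * cis (of_int n * (\<theta>x - pi / 2))
            * scat_coeff B \<sigma> \<mu> \<omega> n m)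
          has_sum far_field B \<sigma> \<mu> \<omega> \<theta>\<xi> \<theta>x) (UNIV :: (int \<times> int) set)"
  by (rule scattering_expansion[OF assms(1,12,13,21)])

end
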